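(* Let $\lambda>0$ be fixed and let $k$ be a fixed integer with $k>\max\{\frac{3}{2\lambda},4\}$. There exists $\delta>0$, depending on $\lambda$ and $k$, such that for every odd prime $p$, with $q=p^k$, every $N\ge q^{\lambda}$, and every integer $\beta$ with $(\beta,p)=1$, $$\sum_{1\le n\le N} S(n,\beta;q) \ll N q^{\frac{1}{2}-\delta},$$ where $S(n,\beta;q)$ denotes the Kloosterman sum and the implied constant depends on $\lambda$ and $k$.
   Context: For integers $m,n$ and a positive integer $q$, the Kloosterman sum is $$S(m,n;q)=\sum_{\substack{b \bmod q\\ (b,q)=1}} e\Big(\frac{mb+n\overline{b}}{q}\Big),$$ where $e(y)=\exp(2\pi i y)$ and $\overline{b}$ denotes the multiplicative inverse of $b$ modulo $q$. The sum in the claim runs over integers $n$. The notation $A\ll B$ means $|A|\le C B$ for some constant $C>0$ (the implied constant); here $C$ depends only on $\lambda$ and $k$, so that the bound is uniform in $p$, $N$ and $\beta$. *)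

theory Defs
  imports "HOL-Analysis.Analysis" "HOL-Number_Theory.Number_Theory"
    "HOL-Number_Theory.Modular_Inverse"
begin

definition e2pi :: "real \<Rightarrow> complex" where
  "e2pi y = exp (2 * complex_of_real pi * \<i> * complex_of_real y)"

text \<open>
  The residues modulo \<open>q\<close> are represented by \<open>0, \<dots>, q - 1\<close>. The summand does not depend on
  this choice, nor on the representative of the inverse.
\<close>

definition kloosterman :: "int \<Rightarrow> int \<Rightarrow> nat \<Rightarrow> complex" where
  "kloosterman m n q =
     (\<Sum>b | b \<in> {0..<int q} \<and> coprime b (int q).
        e2pi (real_of_int (m * b + n * modular_inverse (int q) b) / real q))"

end

theory Submission
  imports Defs
begin

text \<open>
  A Kloosterman sum modulo \<open>q = p\<^sup>k\<close> localises at the solutions of \<open>n x\<^sup>2 \<equiv> \<beta>\<close>, where it equals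
  a quadratic Gauss sum of size at most \<open>\<surd>q\<close> times \<open>e(2 n x / q)\<close>. Along a residue class
  \<open>n = r + p t\<close> the Gauss sum is constant and \<open>x\<close> is given by the \<open>p\<close>-adic binomial series,
  so the phase is a polynomial in \<open>t\<close> of degree \<open>k - 1\<close> with leading coefficient \<open>A / p\<close>,
  \<open>p\<close> not dividing \<open>A\<close>. Since \<open>N \<ge> q powr \<lambda>\<close> and \<open>k \<lambda> > 3/2\<close>, the variable \<open>t\<close> runs over an
  interval longer than \<open>p powr (1/2 + \<epsilon>)\<close>. Weyl differencing down to degree two then
  leaves a quadratic sum; one more step gives linear sums with frequencies \<open>2 h A / p\<close>, distinct
  modulo \<open>p\<close> for distinct positive \<open>h\<close>, whose total \<open>O(p log p)\<close> beats the square of the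
  interval length. Primes \<open>p \<le> 2 k\<close> are absorbed into the constant.
\<close>

section \<open>Weyl sums with leading coefficient of denominator \<open>p\<close>\<close>

lemma e2pi_cis: "e2pi x = cis (2 * pi * x)"
  by (simp add: e2pi_def cis_conv_exp mult_ac)

lemma e2pi_add: "e2pi (x + y) = e2pi x * e2pi y"
  by (simp add: e2pi_cis cis_mult distrib_left)

lemma norm_e2pi [simp]: "norm (e2pi x) = 1"
  by (simp add: e2pi_cis)

lemma e2pi_of_int [simp]: "e2pi (of_int n) = 1"
  by (simp add: e2pi_cis cis_multiple_2pi)

lemma e2pi_0 [simp]: "e2pi 0 = 1"
  using e2pi_of_int[of 0] by simp

lemma e2pi_diff: "e2pi (x - y) = e2pi x * cnj (e2pi y)"
  by (simp add: e2pi_cis cis_mult cis_cnj right_diff_distrib)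

lemma e2pi_power: "e2pi x ^ n = e2pi (real n * x)"
  unfolding e2pi_cis Complex.DeMoivre by (rule arg_cong[of _ _ cis]) simp

lemma e2pi_cong:
  assumes "[a = b] (mod int q)"
  shows "e2pi (real_of_int a / real q) = e2pi (real_of_int b / real q)"
proof (cases "q = 0")
  case False
  obtain k where k: "a = b + int q * k"
    using assms by (metis cong_iff_lin cong_sym)
  have "real_of_int a / real q = real_of_int b / real q + of_int k"
    using False by (simp add: k field_simps)
  then show ?thesis by (simp add: e2pi_add)
qed auto

lemma e2pi_eq_1_imp_dvd:
  assumes "q > 0" "e2pi (real_of_int a / real q) = 1"
  shows "int q dvd a"
proof -
  have "cos (2 * pi * (real_of_int a / real q)) = 1"
    using assms(2) by (metis e2pi_cis cis.sel(1) one_complex.sel(1))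
  then obtain n :: int where "2 * pi * (real_of_int a / real q) = n * (2 * pi)"
    by (auto simp: cos_one_2pi_int)
  then have "(2 * pi) * (real_of_int a / real q) = (2 * pi) * of_int n" by (simp only: mult_ac)
  then have "real_of_int a / real q = of_int n" unfolding mult_cancel_left using pi_gt_zero by simp
  then have "real_of_int a = of_int (n * int q)" using assms(1) by (simp add: field_simps)
  then have "a = n * int q" by (simp only: of_int_eq_iff)
  then show ?thesis by simp
qed

lemma norm_1_minus_e2pi: "norm (1 - e2pi x) = 2 * \<bar>sin (pi * x)\<bar>"
proof -
  have "(norm (1 - e2pi x))\<^sup>2 = (1 - cos (2 * (pi * x)))\<^sup>2 + (sin (2 * (pi * x)))\<^sup>2"
    by (simp add: e2pi_cis cmod_power2 mult_ac)
  also have "\<dots> = 2 - 2 * cos (2 * (pi * x))"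
    using sin_cos_squared_add[of "2 * (pi * x)"] by (simp add: power2_eq_square algebra_simps)
  also have "\<dots> = (2 * \<bar>sin (pi * x)\<bar>)\<^sup>2"
    unfolding cos_double_sin by (simp add: power_mult_distrib)
  finally show ?thesis
    by (metis abs_ge_zero mult_nonneg_nonneg norm_ge_zero power2_eq_imp_eq zero_le_numeral)
qed

lemma sum_int_interval_reindex:
  fixes f :: "int \<Rightarrow> 'a :: comm_monoid_add"
  assumes "a \<le> b"
  shows "(\<Sum>t\<in>{a..<b}. f t) = (\<Sum>j<nat (b - a). f (a + int j))"
  by (rule sum.reindex_bij_witness[of _ "\<lambda>j. a + int j" "\<lambda>t. nat (t - a)"]) (use assms in auto)

text \<open>A geometric series with ratio \<open>e2pi x\<close>: the numerator has modulus at most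
  2, the denominator has modulus \<open>2 * \<bar>sin (pi * x)\<bar>\<close>.\<close>

lemma norm_linear_sum_le:
  assumes "sin (pi * x) \<noteq> 0"
  shows "norm (\<Sum>t\<in>{a..<b}. e2pi (real_of_int t * x + c)) \<le> 1 / \<bar>sin (pi * x)\<bar>"
proof (cases "a \<le> b")
  case True
  have ne: "e2pi x \<noteq> 1"
    using norm_1_minus_e2pi[of x] assms by auto
  have "(\<Sum>t\<in>{a..<b}. e2pi (real_of_int t * x + c))
      = (\<Sum>j<nat (b - a). e2pi (real_of_int a * x + c) * e2pi x ^ j)"
    unfolding sum_int_interval_reindex[OF True]
    by (simp add: e2pi_power e2pi_add[symmetric] algebra_simps)
  also have "\<dots> = e2pi (real_of_int a * x + c) * ((1 - e2pi x ^ nat (b - a)) / (1 - e2pi x))"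
    using ne by (simp add: sum_distrib_left[symmetric] sum_gp_strict)
  finally have "norm (\<Sum>t\<in>{a..<b}. e2pi (real_of_int t * x + c))
      = norm (1 - e2pi x ^ nat (b - a)) / (2 * \<bar>sin (pi * x)\<bar>)"
    by (simp add: norm_mult norm_divide norm_1_minus_e2pi)
  also have "norm (1 - e2pi x ^ nat (b - a)) \<le> 2"
    using norm_triangle_ineq4[of 1 "e2pi x ^ nat (b - a)"] by (simp add: norm_power)
  finally show ?thesis by (simp add: divide_right_mono field_simps)
qed simp

lemma sin_pi_ge:
  assumes "0 \<le> x" "x \<le> 1 / 2"
  shows "x \<le> sin (pi * x)"
proof -
  define y where "y = pi * x"
  \<comment> \<open>The crude bound 3.2 gives \<open>y \<le> 1.6\<close>, so the cubic Taylor error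
    is at most \<open>2.56 / 6\<close> times \<open>y\<close>; more than half of
    \<open>y \<ge> 3 * x\<close> survives.\<close>
  have p: "3 \<le> pi" "pi \<le> 3.2" using pi_approx(1,2) by auto
  have y: "0 \<le> y" "y \<le> 1.6"
    using assms p mult_mono[of pi "3.2" x "1/2"] by (simp_all add: y_def)
  have "\<bar>sin y - (\<Sum>m<3. sin_coeff m * y ^ m)\<bar> \<le> inverse (fact 3) * \<bar>y\<bar> ^ 3"
    by (rule Maclaurin_sin_bound)
  then have "\<bar>sin y - y\<bar> \<le> y ^ 3 / 6"
    using y by (simp add: sin_coeff_def eval_nat_numeral)
  then have "sin y \<ge> y - y ^ 3 / 6" by linarith
  moreover have "y ^ 3 \<le> 2.56 * y"
    using mult_mono[of y "1.6" y "1.6"] y mult_right_mono[of "y * y" "2.56" y]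
    by (simp add: power3_eq_cube)
  moreover have "3 * x \<le> y" using p assms by (simp add: y_def mult_right_mono)
  ultimately show ?thesis using assms by (simp add: y_def)
qed

text \<open>The distance from \<open>r / p\<close> to the nearest integer is \<open>r / p\<close> or
  \<open>(p - r) / p\<close>. Adding both reciprocals avoids a case split and makes the later sum
  over \<open>r\<close> two harmonic sums.\<close>

lemma inverse_sin_le:
  assumes "0 < r" "r < p"
  shows "sin (pi * (real r / real p)) > 0"
    and "1 / \<bar>sin (pi * (real r / real p))\<bar> \<le> real p / real r + real p / real (p - r)"
proof -
  have main: "real r / real p \<le> sin (pi * (real r / real p)) \<or>
      real (p - r) / real p \<le> sin (pi * (real r / real p))"
  proof (cases "2 * r \<le> p")
    case True
    then have "real r / real p \<le> 1 / 2" using assms by (simp add: field_simps)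
    then show ?thesis using sin_pi_ge[of "real r / real p"] by simp
  next
    case False
    then have "real (p - r) / real p \<le> 1 / 2" using assms by (simp add: field_simps of_nat_diff)
    then have "real (p - r) / real p \<le> sin (pi * (real (p - r) / real p))"
      using sin_pi_ge[of "real (p - r) / real p"] by simp
    also have "pi * (real (p - r) / real p) = pi - pi * (real r / real p)"
      using assms by (simp add: field_simps of_nat_diff)
    also have "sin \<dots> = sin (pi * (real r / real p))" by simp
    finally show ?thesis by simp
  qed
  have pos: "0 < real r / real p" "0 < real (p - r) / real p" using assms by simp_all
  then show gt: "sin (pi * (real r / real p)) > 0" using main by linarith
  define s where "s = sin (pi * (real r / real p))"
  have "1 / s \<le> real p / real r \<or> 1 / s \<le> real p / real (p - r)"
    using main le_imp_inverse_le[OF _ pos(1), of s] le_imp_inverse_le[OF _ pos(2), of s]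
    unfolding s_def[symmetric] inverse_eq_divide by fastforce
  moreover have "0 \<le> real p / real r" "0 \<le> real p / real (p - r)" by simp_all
  ultimately have "1 / s \<le> real p / real r + real p / real (p - r)"
    by (meson add_increasing add_increasing2)
  then show "1 / \<bar>sin (pi * (real r / real p))\<bar> \<le> real p / real r + real p / real (p - r)"
    using gt by (simp add: s_def)
qed

text \<open>The difference \<open>harm n - ln n\<close> decreases and equals 1 at
  \<open>n = 1\<close>.\<close>

lemma harm_le_ln: "n > 0 \<Longrightarrow> harm n \<le> 1 + ln (real n)"
proof -
  assume n: "n > 0"
  have "harm (Suc (n-1)) - ln (Suc (n-1)) \<le> harm (Suc 0) - ln (Suc 0 :: real)"
    using decseq_harm_diff_ln[unfolded decseq_def] by (meson le0)
  then show ?thesis using n by (simp add: harm_expand)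
qed

lemma sum_inverse_sin_le:
  assumes "p > 1"
  shows "(\<Sum>r\<in>{0<..<p}. 1 / \<bar>sin (pi * (real r / real p))\<bar>) \<le> 2 * real p * (1 + ln (real p))"
proof -
  have "(\<Sum>r\<in>{0<..<p}. 1 / \<bar>sin (pi * (real r / real p))\<bar>)
      \<le> (\<Sum>r\<in>{0<..<p}. real p / real r + real p / real (p - r))"
    by (intro sum_mono inverse_sin_le) auto
  also have "\<dots> = (\<Sum>r\<in>{0<..<p}. real p / real r) + (\<Sum>r\<in>{0<..<p}. real p / real (p - r))"
    by (rule sum.distrib)
  also have "(\<Sum>r\<in>{0<..<p}. real p / real (p - r)) = (\<Sum>r\<in>{0<..<p}. real p / real r)"
    by (rule sum.reindex_bij_witness[of _ "\<lambda>r. p - r" "\<lambda>r. p - r"]) auto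
  also have "(\<Sum>r\<in>{0<..<p}. real p / real r) = real p * harm (p - 1)"
  proof -
    have "{0<..<p} = {1..p-1}" using assms by auto
    then show ?thesis by (simp add: harm_def sum_distrib_left divide_inverse)
  qed
  also have "harm (p - 1) \<le> 1 + ln (real p)"
  proof -
    have "harm (p - 1) \<le> 1 + ln (real (p - 1))" using assms by (intro harm_le_ln) auto
    also have "ln (real (p - 1)) \<le> ln (real p)" using assms by simp
    finally show ?thesis by simp
  qed
  finally show ?thesis using assms by (simp add: mult_left_mono)
qed

text \<open>The squared modulus is a double sum over pairs \<open>(u, t)\<close>, grouped here by
  the shift \<open>h = u - t\<close>. The diagonal contributes the length of the interval; for fixed
  \<open>h\<close>, the variable \<open>t\<close> runs over the intersection of the interval with
  its translate by \<open>-h\<close>.\<close>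

lemma weyl_differencing:
  fixes f :: "int \<Rightarrow> real" and a b :: int
  assumes "a \<le> b"
  shows "(norm (\<Sum>t\<in>{a..<b}. e2pi (f t)))\<^sup>2 \<le> real_of_int (b - a) +
    (\<Sum>h\<in>{-(b-a)<..<b-a} - {0}.
       norm (\<Sum>t\<in>{max a (a - h)..<min b (b - h)}. e2pi (f (t + h) - f t)))"
proof (cases "a = b")
  case False
  let ?I = "{a..<b}" and ?D = "{-(b-a)<..<b-a}"
  let ?J = "\<lambda>h. {max a (a - h)..<min b (b - h)}"
  let ?g = "\<lambda>h t. e2pi (f (t + h) - f t)"
  have D0: "0 \<in> ?D" using assms False by auto
  have "of_real ((norm (\<Sum>t\<in>?I. e2pi (f t)))\<^sup>2) = (\<Sum>u\<in>?I. e2pi (f u)) * cnj (\<Sum>t\<in>?I. e2pi (f t))"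
    by (rule complex_norm_square)
  also have "\<dots> = (\<Sum>(u,t)\<in>?I \<times> ?I. e2pi (f u - f t))"
    by (simp add: sum_product sum.cartesian_product e2pi_diff)
  also have "\<dots> = (\<Sum>(h,t)\<in>Sigma ?D ?J. ?g h t)"
    by (rule sum.reindex_bij_witness[of _ "\<lambda>(h,t). (t + h, t)" "\<lambda>(u,t). (u - t, t)"]) auto
  also have "\<dots> = (\<Sum>h\<in>?D. \<Sum>t\<in>?J h. ?g h t)"
    by (rule sum.Sigma[symmetric]) auto
  finally have "(norm (\<Sum>t\<in>?I. e2pi (f t)))\<^sup>2 = norm (\<Sum>h\<in>?D. \<Sum>t\<in>?J h. ?g h t)"
    by (metis norm_of_real abs_of_nonneg zero_le_power2)
  also have "\<dots> \<le> (\<Sum>h\<in>?D. norm (\<Sum>t\<in>?J h. ?g h t))" by (rule norm_sum)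
  also have "\<dots> = norm (\<Sum>t\<in>?J 0. ?g 0 t) + (\<Sum>h\<in>?D - {0}. norm (\<Sum>t\<in>?J h. ?g h t))"
    using D0 by (intro sum.remove) auto
  also have "norm (\<Sum>t\<in>?J 0. ?g 0 t) = real_of_int (b - a)"
    using assms by (simp flip: of_int_diff)
  finally show ?thesis .
qed simp

section \<open>Difference polynomials and Weyl sums of degree at least two\<close>

definition poly_diff :: "real \<Rightarrow> real poly \<Rightarrow> real poly" where
  "poly_diff h g = pcompose g [:h, 1:] - g"

lemma poly_poly_diff: "poly (poly_diff h g) x = poly g (x + h) - poly g x"
  by (simp add: poly_diff_def poly_pcompose add_ac)

text \<open>Degrees are only bounded from above, so \<open>h = 0\<close> and a vanishing top
  coefficient are not special cases. The induction needs the degree bound and the coefficient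
  formula together.\<close>

lemma poly_diff_leading:
  "degree g \<le> Suc n \<Longrightarrow>
     degree (poly_diff h g) \<le> n \<and> poly.coeff (poly_diff h g) n = real (Suc n) * h * poly.coeff g (Suc n)"
proof (induction g arbitrary: n)
  case 0
  then show ?case by (simp add: poly_diff_def)
next
  case (pCons c g)
  have deg: "degree g \<le> n" using pCons by (simp split: if_splits)
  have comp: "pcompose g [:h, 1:] = poly_diff h g + g" by (simp add: poly_diff_def)
  \<comment> \<open>The product rule for differences: \<open>(x + h) g(x + h) - x g(x)\<close> is
    \<open>x\<close> times the difference of \<open>g\<close>, plus \<open>h\<close> times
    \<open>g(x + h)\<close>.\<close>
  have eq: "poly_diff h (pCons c g) = pCons 0 (poly_diff h g) + Polynomial.smult h (poly_diff h g + g)"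
    unfolding poly_diff_def by (simp add: pcompose_pCons algebra_simps)
  show ?case
  proof (cases n)
    case 0
    then obtain d where "g = [:d:]" using deg by (auto elim: degree_eq_zeroE)
    then show ?thesis unfolding eq by (simp add: 0 poly_diff_def pcompose_pCons)
  next
    case (Suc m)
    have IH: "degree (poly_diff h g) \<le> m"
      "poly.coeff (poly_diff h g) m = real (Suc m) * h * poly.coeff g (Suc m)"
      using pCons.IH[of m] deg Suc by auto
    have "degree (pCons 0 (poly_diff h g)) \<le> n"
      using IH Suc by (simp add: degree_pCons_eq_if)
    moreover have "degree (Polynomial.smult h (poly_diff h g + g)) \<le> n"
      using IH deg Suc by (intro order.trans[OF degree_smult_le] degree_add_le) auto
    ultimately have "degree (poly_diff h (pCons c g)) \<le> n"
      unfolding eq by (rule degree_add_le)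
    moreover have "poly.coeff (poly_diff h g) n = 0" using IH Suc by (intro coeff_eq_0) auto
    ultimately show ?thesis unfolding eq using IH Suc by (simp add: algebra_simps)
  qed
qed

text \<open>Multiplication by the unit \<open>c\<close> sends the distinct nonzero residues in
  \<open>H\<close> to distinct nonzero residues. The summand depends only on the residue modulo
  \<open>p\<close>, so the sum is part of the complete sum over \<open>0 < r < p\<close>.\<close>

lemma sum_inverse_sin_progression_le:
  fixes p :: nat and c :: int and H :: "int set"
  assumes p: "p > 1" and c: "coprime c (int p)" and "finite H"
    and H: "\<And>h. h \<in> H \<Longrightarrow> \<not> int p dvd h"
    and inj: "\<And>h h'. h \<in> H \<Longrightarrow> h' \<in> H \<Longrightarrow> [h = h'] (mod int p) \<Longrightarrow> h = h'"
  shows "(\<Sum>h\<in>H. 1 / \<bar>sin (pi * (real_of_int (h * c) / real p))\<bar>) \<le> 2 * real p * (1 + ln (real p))"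
proof -
  define r where "r = (\<lambda>h. nat (h * c mod int p))"
  define F where "F = (\<lambda>m. 1 / \<bar>sin (pi * (real m / real p))\<bar>)"
  have r_int: "int (r h) = h * c mod int p" for h using p by (simp add: r_def)
  \<comment> \<open>Periodicity is read off from \<open>e2pi\<close>, because
    \<open>sin (pi * x)\<close> itself may change sign when \<open>x\<close> moves by an
    integer.\<close>
  have abs_sin: "\<bar>sin (pi * x)\<bar> = norm (1 - e2pi x) / 2" for x
    by (simp add: norm_1_minus_e2pi)
  have "(\<Sum>h\<in>H. 1 / \<bar>sin (pi * (real_of_int (h * c) / real p))\<bar>) = (\<Sum>h\<in>H. F (r h))"
  proof (rule sum.cong)
    fix h
    have "e2pi (real_of_int (h * c) / real p) = e2pi (real_of_int (int (r h)) / real p)"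
      by (rule e2pi_cong) (simp add: r_int)
    then show "1 / \<bar>sin (pi * (real_of_int (h * c) / real p))\<bar> = F (r h)"
      unfolding F_def abs_sin by simp
  qed simp
  also have "\<dots> = sum F (r ` H)"
  proof (rule sum.reindex_cong[symmetric, OF _ refl refl])
    show "inj_on r H"
    proof (rule inj_onI)
      fix h h' assume h: "h \<in> H" "h' \<in> H" "r h = r h'"
      then have "[h * c = h' * c] (mod int p)" by (metis r_int cong_def)
      then have "[h = h'] (mod int p)" using c cong_mult_rcancel by blast
      then show "h = h'" using inj h by blast
    qed
  qed
  also have "\<dots> \<le> sum F {0<..<p}"
  proof (rule sum_mono2)
    show "r ` H \<subseteq> {0<..<p}"
    proof safe
      fix h assume h: "h \<in> H"
      have "\<not> int p dvd h * c" using H[OF h] c by (metis coprime_commute coprime_dvd_mult_left_iff)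
      then have "int (r h) \<noteq> 0" by (simp add: r_int dvd_eq_mod_eq_0)
      moreover have "int (r h) < int p" using p by (simp add: r_int)
      ultimately show "r h \<in> {0<..<p}" by simp
    qed
  qed (auto simp: F_def)
  also have "\<dots> \<le> 2 * real p * (1 + ln (real p))"
    unfolding F_def by (rule sum_inverse_sin_le[OF p])
  finally show ?thesis .
qed

text \<open>One differencing step leaves linear phases of slope \<open>2 * h * A / p\<close>, and
  \<open>2 * A\<close> is a unit modulo the odd prime \<open>p\<close>.\<close>

lemma weyl_quadratic:
  fixes p :: nat and A a b :: int and g :: "real poly"
  assumes p: "prime p" "odd p" and A: "\<not> int p dvd A"
    and g: "degree g \<le> 2" "poly.coeff g 2 = real_of_int A / real p"
    and ab: "a \<le> b" "b - a < int p"
  shows "(norm (\<Sum>t\<in>{a..<b}. e2pi (poly g (real_of_int t))))\<^sup>2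
           \<le> real_of_int (b - a) + 4 * real p * (1 + ln (real p))"
proof -
  define F where "F = (\<lambda>m::int. 1 / \<bar>sin (pi * (real_of_int m / real p))\<bar>)"
  have p1: "p > 1" using p prime_gt_1_nat by blast
  have cop: "coprime (2 * A) (int p)"
    using p A by (metis coprime_commute coprime_mult_left_iff prime_imp_coprime prime_nat_int_transfer
        prime_odd_int dvd_refl coprime_left_2_iff_odd even_of_nat_iff)
  have ndvd: "\<not> int p dvd h" if "h \<noteq> 0" "\<bar>h\<bar> < int p" for h
    using that zdvd_not_zless[of "\<bar>h\<bar>" "int p"] by auto
  have inner: "norm (\<Sum>t\<in>{u..<v}. e2pi (poly g (real_of_int (t + h)) - poly g (real_of_int t)))
                \<le> F (h * (2 * A))" if h: "h \<noteq> 0" "\<bar>h\<bar> < int p" for h u v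
  proof -
    let ?d = "poly_diff (real_of_int h) g"
    have d: "degree ?d \<le> 1" "poly.coeff ?d 1 = real_of_int (h * (2 * A)) / real p"
      using poly_diff_leading[of g 1 "real_of_int h"] g by (simp_all add: numeral_2_eq_2)
    then have "?d = [:poly.coeff ?d 0, poly.coeff ?d 1:]"
      by (intro poly_eqI) (auto simp: coeff_pCons coeff_eq_0 split: nat.splits)
    then have lin: "poly ?d x = x * (real_of_int (h * (2 * A)) / real p) + poly.coeff ?d 0" for x
      using d(2) by (metis poly_pCons poly_0 mult_zero_right add.right_neutral add.commute)
    have "\<not> int p dvd h * (2 * A)"
      using ndvd[OF h] cop by (metis coprime_commute coprime_dvd_mult_left_iff)
    then have "e2pi (real_of_int (h * (2 * A)) / real p) \<noteq> 1"
      using e2pi_eq_1_imp_dvd[of p] p1 by auto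
    then have "sin (pi * (real_of_int (h * (2 * A)) / real p)) \<noteq> 0"
      using norm_1_minus_e2pi[of "real_of_int (h * (2 * A)) / real p"] by auto
    then have "norm (\<Sum>t\<in>{u..<v}. e2pi (real_of_int t * (real_of_int (h * (2 * A)) / real p)
         + poly.coeff ?d 0)) \<le> F (h * (2 * A))"
      unfolding F_def by (rule norm_linear_sum_le)
    then show ?thesis
      unfolding lin[symmetric] by (simp add: poly_poly_diff)
  qed
  let ?D = "{-(b-a)<..<b-a} - {0}"
  have "(norm (\<Sum>t\<in>{a..<b}. e2pi (poly g (real_of_int t))))\<^sup>2 \<le> real_of_int (b - a) +
      (\<Sum>h\<in>?D. norm (\<Sum>t\<in>{max a (a - h)..<min b (b - h)}.
          e2pi (poly g (real_of_int (t + h)) - poly g (real_of_int t))))"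
    by (rule weyl_differencing[OF ab(1), of "\<lambda>t. poly g (real_of_int t)"])
  also have "(\<Sum>h\<in>?D. norm (\<Sum>t\<in>{max a (a - h)..<min b (b - h)}.
          e2pi (poly g (real_of_int (t + h)) - poly g (real_of_int t)))) \<le> (\<Sum>h\<in>?D. F (h * (2 * A)))"
    using ab by (intro sum_mono inner) auto
  \<comment> \<open>Shifts of opposite sign can be congruent modulo \<open>p\<close>, as
    \<open>b - a\<close> may exceed \<open>p / 2\<close>. Within one sign the residues are distinct,
    so each half costs \<open>2 * p * (1 + ln p)\<close>.\<close>
  also have "\<dots> = (\<Sum>h\<in>{-(b-a)<..<0}. F (h * (2 * A))) + (\<Sum>h\<in>{0<..<b-a}. F (h * (2 * A)))"
    by (subst sum.union_disjoint[symmetric]) (auto intro!: sum.cong)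
  also have "(\<Sum>h\<in>{-(b-a)<..<0}. F (h * (2 * A))) \<le> 2 * real p * (1 + ln (real p))"
    unfolding F_def
  proof (rule sum_inverse_sin_progression_le[OF p1 cop])
    fix h h' assume h: "h \<in> {-(b-a)<..<0}" "h' \<in> {-(b-a)<..<0}" "[h = h'] (mod int p)"
    then have "int p dvd h - h'" by (simp add: cong_iff_dvd_diff)
    moreover have "\<bar>h - h'\<bar> < int p" using h(1,2) ab by (auto simp: abs_less_iff)
    ultimately show "h = h'" using ndvd[of "h - h'"] by auto
  qed (use ndvd ab in auto)
  also have "(\<Sum>h\<in>{0<..<b-a}. F (h * (2 * A))) \<le> 2 * real p * (1 + ln (real p))"
    unfolding F_def
  proof (rule sum_inverse_sin_progression_le[OF p1 cop])
    fix h h' assume h: "h \<in> {0<..<b-a}" "h' \<in> {0<..<b-a}" "[h = h'] (mod int p)"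
    then have "int p dvd h - h'" by (simp add: cong_iff_dvd_diff)
    moreover have "\<bar>h - h'\<bar> < int p" using h(1,2) ab by (auto simp: abs_less_iff)
    ultimately show "h = h'" using ndvd[of "h - h'"] by auto
  qed (use ndvd ab in auto)
  finally show ?thesis by (simp add: algebra_simps)
qed

text \<open>Induction on the degree, starting from the quadratic case. Differencing lowers the
  degree by one and multiplies \<open>A\<close> by the degree and by \<open>h\<close>, both prime to
  \<open>p\<close>; the saving \<open>\<delta>\<close> is halved. Since
  \<open>\<epsilon> \<le> 1 / 4\<close>, the interval is shorter than \<open>p\<close>. The clause
  \<open>\<delta> \<le> 1 / 2\<close> is carried along to control the diagonal term.\<close>

lemma weyl_bound:
  fixes \<epsilon> :: real
  assumes eps: "0 < \<epsilon>" "\<epsilon> \<le> 1 / 4" and "d \<ge> 2"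
  shows "\<exists>C>0. \<exists>\<delta>>0. \<delta> \<le> 1 / 2 \<and> (\<forall>p A a b g. prime p \<longrightarrow> odd p \<longrightarrow> d < p \<longrightarrow> \<not> int p dvd A \<longrightarrow>
           degree g \<le> d \<longrightarrow> poly.coeff g d = real_of_int A / real p \<longrightarrow>
           real_of_int (b - a) \<le> real p powr (1 / 2 + \<epsilon>) \<longrightarrow>
           norm (\<Sum>t\<in>{a..<b}. e2pi (poly g (real_of_int t))) \<le> C * real p powr (1 / 2 + \<epsilon> - \<delta>))"
  using \<open>d \<ge> 2\<close>
proof (induction d rule: nat_induct_at_least)
  case base
  \<comment> \<open>The squared sum is at most \<open>5 * p + 4 * p * ln p\<close>, and
    \<open>ln p \<le> p powr \<epsilon> / \<epsilon>\<close>. This gives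
    \<open>p powr (1 + \<epsilon>)\<close>, whose root saves \<open>\<epsilon> / 2\<close> in the
    exponent.\<close>
  define C where "C = sqrt (5 + 4 / \<epsilon>)"
  show ?case
  proof (intro exI conjI allI impI)
    show "C > 0" "\<epsilon> / 2 > 0" "\<epsilon> / 2 \<le> 1 / 2" using eps by (auto simp: C_def add_pos_pos)
    fix p :: nat and A a b :: int and g :: "real poly"
    assume p: "prime p" "odd p" and A: "\<not> int p dvd A"
      and g: "degree g \<le> 2" "poly.coeff g 2 = real_of_int A / real p"
      and L: "real_of_int (b - a) \<le> real p powr (1 / 2 + \<epsilon>)"
    have p1: "real p > 1" using p prime_gt_1_nat by simp
    let ?S = "\<Sum>t\<in>{a..<b}. e2pi (poly g (real_of_int t))"
    show "norm ?S \<le> C * real p powr (1 / 2 + \<epsilon> - \<epsilon> / 2)"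
    proof (cases "a \<le> b")
      case True
      have "real p powr (1 / 2 + \<epsilon>) < real p powr 1"
        using p1 eps by (intro powr_less_mono) auto
      then have lt: "real_of_int (b - a) < real p" using L p1 by simp
      then have "b - a < int p" by linarith
      then have "(norm ?S)\<^sup>2 \<le> real_of_int (b - a) + 4 * real p * (1 + ln (real p))"
        by (intro weyl_quadratic[OF p A g True])
      also have "\<dots> \<le> 5 * real p + 4 * real p * ln (real p)"
        using lt by (simp add: algebra_simps)
      also have "\<dots> \<le> 5 * (real p * real p powr \<epsilon>) + 4 * real p * (real p powr \<epsilon> / \<epsilon>)"
      proof (intro add_mono mult_left_mono)
        show "real p \<le> real p * real p powr \<epsilon>"
          using p1 eps by (simp add: ge_one_powr_ge_zero)
        show "ln (real p) \<le> real p powr \<epsilon> / \<epsilon>"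
          using ln_powr_bound[of "real p" \<epsilon>] p1 eps by simp
      qed auto
      also have "\<dots> = (5 + 4 / \<epsilon>) * (real p powr (1 + \<epsilon>))"
        using p1 by (simp add: powr_add algebra_simps)
      also have "\<dots> = (C * real p powr (1 / 2 + \<epsilon> - \<epsilon> / 2))\<^sup>2"
        using eps p1 by (simp add: C_def power_mult_distrib powr_power algebra_simps)
      finally show ?thesis
        by (rule power2_le_imp_le) (use eps in \<open>simp add: C_def\<close>)
    qed (use eps in \<open>simp add: C_def\<close>)
  qed
next
  case (Suc d)
  then obtain C \<delta> where C: "C > 0" and \<delta>: "\<delta> > 0" "\<delta> \<le> 1 / 2"
    and IH: "\<And>p A a b g. prime p \<Longrightarrow> odd p \<Longrightarrow> d < p \<Longrightarrow> \<not> int p dvd A \<Longrightarrow>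
           degree g \<le> d \<Longrightarrow> poly.coeff g d = real_of_int A / real p \<Longrightarrow>
           real_of_int (b - a) \<le> real p powr (1 / 2 + \<epsilon>) \<Longrightarrow>
           norm (\<Sum>t\<in>{a..<b}. e2pi (poly g (real_of_int t))) \<le> C * real p powr (1 / 2 + \<epsilon> - \<delta>)"
    by blast
  \<comment> \<open>The 1 is for the diagonal term; the \<open>2 * C\<close> is for fewer than
    \<open>2 * (b - a)\<close> nonzero shifts, each bounded by the induction hypothesis.\<close>
  define C' where "C' = sqrt (1 + 2 * C)"
  show ?case
  proof (intro exI conjI allI impI)
    show "C' > 0" "\<delta> / 2 > 0" "\<delta> / 2 \<le> 1 / 2" using C \<delta> by (auto simp: C'_def)
    fix p :: nat and A a b :: int and g :: "real poly"
    assume p: "prime p" "odd p" "Suc d < p" and A: "\<not> int p dvd A"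
      and g: "degree g \<le> Suc d" "poly.coeff g (Suc d) = real_of_int A / real p"
      and L: "real_of_int (b - a) \<le> real p powr (1 / 2 + \<epsilon>)"
    have p1: "real p > 1" using p prime_gt_1_nat by simp
    let ?S = "\<Sum>t\<in>{a..<b}. e2pi (poly g (real_of_int t))"
    let ?P = "real p powr (1 / 2 + \<epsilon>)"
    show "norm ?S \<le> C' * real p powr (1 / 2 + \<epsilon> - \<delta> / 2)"
    proof (cases "a < b")
      case True
      have "?P < real p powr 1"
        using p1 eps by (intro powr_less_mono) auto
      then have lt: "b - a < int p" using L p1 by simp
      let ?D = "{-(b-a)<..<b-a} - {0}"
      let ?J = "\<lambda>h. {max a (a - h)..<min b (b - h)}"
      have inner: "norm (\<Sum>t\<in>?J h. e2pi (poly g (real_of_int (t + h)) - poly g (real_of_int t)))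
            \<le> C * real p powr (1 / 2 + \<epsilon> - \<delta>)" if h: "h \<in> ?D" for h
      proof -
        let ?d = "poly_diff (real_of_int h) g"
        have "0 < \<bar>h\<bar>" "\<bar>h\<bar> < int p" using h lt by (auto simp: abs_less_iff)
        then have "\<not> int p dvd h" using zdvd_not_zless[of "\<bar>h\<bar>" "int p"] by auto
        moreover have "\<not> int p dvd int (Suc d)"
          using p(3) by (metis dvd_imp_le int_dvd_int_iff not_less zero_less_Suc)
        ultimately have "\<not> int p dvd int (Suc d) * h * A"
          using A p(1) by (metis prime_dvd_mult_iff prime_nat_int_transfer)
        moreover have "degree ?d \<le> d" "poly.coeff ?d d = real_of_int (int (Suc d) * h * A) / real p"
          using poly_diff_leading[of g d "real_of_int h"] g by simp_all
        moreover have "real_of_int (min b (b - h) - max a (a - h)) \<le> ?P"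
          using L by (intro order.trans[OF _ L]) (simp add: min_def max_def)
        ultimately have "norm (\<Sum>t\<in>?J h. e2pi (poly ?d (real_of_int t)))
            \<le> C * real p powr (1 / 2 + \<epsilon> - \<delta>)"
          using p by (intro IH[of p "int (Suc d) * h * A"]) auto
        then show ?thesis by (simp add: poly_poly_diff)
      qed
      have "card ?D \<le> card {-(b-a)<..<b-a}" by (intro card_mono) auto
      moreover have "card ?D = card {-(b-a)<..<b-a} - 1"
        using True by (intro card_Diff_singleton) auto
      ultimately have "real (card ?D) \<le> 2 * real_of_int (b - a)"
        using True by simp
      then have card: "real (card ?D) \<le> 2 * ?P"
        by (rule order.trans) (intro mult_left_mono L, simp)
      have "(norm ?S)\<^sup>2 \<le> real_of_int (b - a) + (\<Sum>h\<in>?D. norm (\<Sum>t\<in>?J h.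
          e2pi (poly g (real_of_int (t + h)) - poly g (real_of_int t))))"
        by (rule weyl_differencing[of a b "\<lambda>t. poly g (real_of_int t)"]) (use True in simp)
      also have "\<dots> \<le> ?P + (\<Sum>h\<in>?D. C * real p powr (1 / 2 + \<epsilon> - \<delta>))"
        by (intro add_mono L sum_mono inner)
      also have "\<dots> \<le> ?P + (2 * ?P) * (C * real p powr (1 / 2 + \<epsilon> - \<delta>))"
        using mult_right_mono[OF card, of "C * real p powr (1 / 2 + \<epsilon> - \<delta>)"] C by simp
      also have "\<dots> = ?P + 2 * C * real p powr (1 + 2 * \<epsilon> - \<delta>)"
      proof -
        have "?P * real p powr (1 / 2 + \<epsilon> - \<delta>) = real p powr (1 + 2 * \<epsilon> - \<delta>)"
          by (subst powr_add[symmetric]) (rule arg_cong[of _ _ "\<lambda>x. real p powr x"], simp)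
        then show ?thesis by (metis mult.assoc mult.left_commute)
      qed
      \<comment> \<open>The bound \<open>\<delta> \<le> 1 / 2\<close> lets the diagonal term be
        absorbed.\<close>
      also have "?P \<le> real p powr (1 + 2 * \<epsilon> - \<delta>)"
        using \<delta> eps p1 by (intro powr_mono) auto
      finally have "(norm ?S)\<^sup>2 \<le> (1 + 2 * C) * real p powr (1 + 2 * \<epsilon> - \<delta>)"
        by (simp add: algebra_simps)
      also have "\<dots> = (C' * real p powr (1 / 2 + \<epsilon> - \<delta> / 2))\<^sup>2"
        using C p1 by (simp add: C'_def power_mult_distrib powr_power algebra_simps)
      finally show ?thesis
        by (rule power2_le_imp_le) (use C in \<open>simp add: C'_def\<close>)
    qed (use C in \<open>simp add: C'_def\<close>)
  qed
qed

text \<open>The Weyl bound concerns intervals of restricted length, so long ones are cut into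
  blocks. The hypothesis covers every interval of length at most \<open>L\<close>, hence also an
  incomplete last block.\<close>

lemma norm_sum_blocks_le:
  fixes z :: "int \<Rightarrow> complex"
  assumes "L > 0" "\<And>a b. b - a \<le> int L \<Longrightarrow> norm (sum z {a..<b}) \<le> B"
  shows "b - a \<le> int (m * L) \<Longrightarrow> norm (sum z {a..<b}) \<le> real m * B"
proof (induction m arbitrary: a)
  case (Suc m)
  have B: "B \<ge> 0" using assms(2)[of 0 0] by simp
  show ?case
  proof (cases "a + int L \<le> b")
    case True
    have "sum z {a..<b} = sum z {a..<a + int L} + sum z {a + int L..<b}"
      using True assms(1) by (subst sum.union_disjoint[symmetric]) (auto simp: ivl_disj_un)
    also have "norm \<dots> \<le> B + real m * B"
      using Suc.prems by (intro norm_triangle_le add_mono assms(2) Suc.IH) auto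
    finally show ?thesis by (simp add: algebra_simps)
  next
    case False
    then have "norm (sum z {a..<b}) \<le> B" by (intro assms(2)) auto
    then show ?thesis using B by (simp add: distrib_right add_increasing2)
  qed
qed simp

section \<open>The binomial series of the square root with integer coefficients\<close>

lemma gbinomial_half_square:
  "(\<Sum>i\<le>n. ((1/2::real) gchoose i) * ((1/2) gchoose (n - i))) = (1 gchoose n)"
  using gbinomial_Vandermonde[of "1/2::real" "1/2" n] by (simp add: atMost_atLeast0)

text \<open>The witnesses are \<open>4 ^ n\<close> times the binomial coefficient of 1/2 over
  \<open>n\<close>, the Taylor coefficients of the square root of \<open>1 + 4 x\<close>.
  Vandermonde gives the convolution identity and from it integrality; the ratio of consecutive
  coefficients gives non-divisibility by \<open>p\<close>.\<close>

lemma ex_sqrt_coeffs: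
  "\<exists>a::nat \<Rightarrow> int. a 0 = 1 \<and> a 1 = 2 \<and> (\<forall>n\<ge>2. (\<Sum>i\<le>n. a i * a (n - i)) = 0) \<and>
     (\<forall>p n. prime p \<longrightarrow> odd p \<longrightarrow> p > 2 * n \<longrightarrow> \<not> int p dvd a n)"
proof -
  define r where "r = (\<lambda>n. 4 ^ n * ((1/2::real) gchoose n))"
  have conv: "(\<Sum>i\<le>n. r i * r (n - i)) = 4 ^ n * (1 gchoose n)" for n
  proof -
    have "(\<Sum>i\<le>n. r i * r (n - i)) =
        (\<Sum>i\<le>n. 4 ^ n * (((1/2::real) gchoose i) * ((1/2) gchoose (n - i))))"
    proof (rule sum.cong)
      fix i assume "i \<in> {..n}"
      then have "(4::real) ^ n = 4 ^ i * 4 ^ (n - i)" by (simp flip: power_add)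
      then show "r i * r (n - i) = 4 ^ n * (((1/2::real) gchoose i) * ((1/2) gchoose (n - i)))"
        by (simp add: r_def)
    qed simp
    then show ?thesis by (simp only: sum_distrib_left[symmetric] gbinomial_half_square)
  qed
  have r0: "r 0 = 1" and r1: "r 1 = 2" by (simp_all add: r_def)
  have zero: "(1::real) gchoose n = 0" if "n \<ge> 2" for n
    using that binomial_gbinomial[of 1 n, where ?'a = real] by (simp add: binomial_eq_0)
  have rec: "real (Suc n) * r (Suc n) = (2 - 4 * real n) * r n" for n
  proof -
    have "real (Suc n) * ((1/2::real) gchoose (Suc n)) = (1/2 - real n) * ((1/2) gchoose n)"
      using gbinomial_mult_1[of "1/2::real" n] by (simp add: algebra_simps)
    then have "4 ^ n * 4 * (real (Suc n) * ((1/2::real) gchoose (Suc n)))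
        = 4 ^ n * 4 * ((1/2 - real n) * ((1/2) gchoose n))" by (simp only:)
    then show ?thesis by (simp add: r_def algebra_simps)
  qed
  \<comment> \<open>Evenness strengthens the induction: the recursion determines
    \<open>2 * r n\<close>, and products of two even terms are divisible by 4, so that
    \<open>r n\<close> is again an even integer.\<close>
  have int_even: "\<exists>m::int. r n = 2 * of_int m" if "n > 0" for n
    using that
  proof (induction n rule: less_induct)
    case (less n)
    show ?case
    proof (cases "n = 1")
      case True
      then show ?thesis using r1 by (intro exI[of _ 1]) simp
    next
      case False
      then have n: "n \<ge> 2" using less.prems by simp
      have "{..n} = insert 0 (insert n {0<..<n})" using n by auto
      then have "(\<Sum>i\<le>n. r i * r (n - i)) = 2 * r n + (\<Sum>i\<in>{0<..<n}. r i * r (n - i))"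
        using n r0 by simp
      then have eq: "2 * r n = - (\<Sum>i\<in>{0<..<n}. r i * r (n - i))"
        using conv[of n] zero[OF n] by simp
      from less.IH have "\<forall>i. \<exists>m. i \<in> {0<..<n} \<longrightarrow> r i = 2 * real_of_int m" by auto
      then obtain m where m: "\<And>i. i \<in> {0<..<n} \<Longrightarrow> r i = 2 * real_of_int (m i)" by metis
      have "(\<Sum>i\<in>{0<..<n}. r i * r (n - i)) = (\<Sum>i\<in>{0<..<n}. 4 * real_of_int (m i * m (n - i)))"
        by (intro sum.cong) (simp_all add: m)
      also have "\<dots> = 4 * real_of_int (\<Sum>i\<in>{0<..<n}. m i * m (n - i))"
        by (simp add: sum_distrib_left)
      finally show ?thesis using eq by (intro exI[of _ "- (\<Sum>i\<in>{0<..<n}. m i * m (n - i))"]) simp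
    qed
  qed
  have "\<exists>m::int. r n = of_int m" for n
  proof (cases "n = 0")
    case True
    then show ?thesis using r0 by (intro exI[of _ 1]) simp
  next
    case False
    then obtain m where "r n = 2 * of_int m" using int_even by blast
    then show ?thesis by (intro exI[of _ "2 * m"]) simp
  qed
  then obtain a where a: "\<And>n. r n = real_of_int (a n)" by metis
  show ?thesis
  proof (intro exI[of _ a] conjI allI impI)
    show "a 0 = 1" "a 1 = 2" using r0 r1 by (simp_all add: a)
    fix n :: nat assume n: "n \<ge> 2"
    have "real_of_int (\<Sum>i\<le>n. a i * a (n - i)) = 0"
      using conv[of n] zero[OF n] by (simp add: a)
    then show "(\<Sum>i\<le>n. a i * a (n - i)) = 0" by (simp only: of_int_eq_0_iff)
  next
    have a0: "a 0 = 1" using r0 by (simp add: a)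
    fix p n :: nat assume p: "prime p" "odd p"
    have rec': "int (Suc n) * a (Suc n) = (2 - 4 * int n) * a n" for n
    proof -
      have "real_of_int (int (Suc n) * a (Suc n)) = real_of_int ((2 - 4 * int n) * a n)"
        using rec[of n] by (simp add: a)
      then show ?thesis by (simp only: of_int_eq_iff)
    qed
    show "p > 2 * n \<Longrightarrow> \<not> int p dvd a n"
    proof (induction n)
      case 0
      then show ?case using a0 p by (auto dest: prime_gt_1_nat)
    next
      case (Suc n)
      show ?case
      proof
        assume "int p dvd a (Suc n)"
        then have "int p dvd (2 - 4 * int n) * a n" using rec'[of n] by (metis dvd_mult)
        moreover have "\<not> int p dvd a n" using Suc by simp
        ultimately have "int p dvd 2 - 4 * int n"
          using p(1) by (metis prime_dvd_mult_iff prime_nat_int_transfer)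
        also have "2 - 4 * int n = 2 * (1 - 2 * int n)" by simp
        finally have "int p dvd 2 * (1 - 2 * int n)" .
        then have "int p dvd 1 - 2 * int n \<or> int p dvd 2"
          using p(1) by (metis prime_dvd_mult_iff prime_nat_int_transfer)
        moreover have "\<not> int p dvd 2"
        proof
          assume "int p dvd 2"
          then have "p dvd 2" by (metis int_dvd_int_iff of_nat_numeral)
          then show False using p by (metis primes_dvd_imp_eq two_is_prime_nat even_numeral)
        qed
        ultimately have "int p dvd 1 - 2 * int n" by simp
        \<comment> \<open>The only new factor in the numerator is \<open>2 * (1 - 2 n)\<close>; its
          odd part is nonzero and too small to be divisible by \<open>p\<close>.\<close>
        moreover have "\<bar>1 - 2 * int n\<bar> < int p" "1 - 2 * int n \<noteq> 0" using Suc.prems by presburger+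
        ultimately show False using zdvd_not_zless[of "\<bar>1 - 2 * int n\<bar>" "int p"] by auto
      qed
    qed
  qed
qed

text \<open>The series truncated below degree \<open>k\<close> has the correct square up to a
  multiple of \<open>x ^ k\<close>. At multiples of \<open>p\<close> this error vanishes modulo
  \<open>p ^ k\<close>.\<close>

lemma ex_sqrt_poly:
  assumes "k \<ge> 2"
  shows "\<exists>P::int poly. degree P \<le> k - 1 \<and> poly.coeff P 0 = 1 \<and>
     Polynomial.monom 1 k dvd P\<^sup>2 - [:1, 4:] \<and>
     (\<forall>p. prime p \<longrightarrow> odd p \<longrightarrow> p > 2 * k \<longrightarrow> \<not> int p dvd poly.coeff P (k - 1))"
proof -
  obtain a :: "nat \<Rightarrow> int" where a: "a 0 = 1" "a 1 = 2" "\<And>n. n \<ge> 2 \<Longrightarrow> (\<Sum>i\<le>n. a i * a (n - i)) = 0"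
     "\<And>p n. prime p \<Longrightarrow> odd p \<Longrightarrow> p > 2 * n \<Longrightarrow> \<not> int p dvd a n"
    using ex_sqrt_coeffs by metis
  define P where "P = Poly (map a [0..<k])"
  have co: "poly.coeff P n = (if n < k then a n else 0)" for n
    by (simp add: P_def coeff_Poly_eq nth_default_def)
  show ?thesis
  proof (intro exI[of _ P] conjI allI impI)
    show "degree P \<le> k - 1" using assms by (intro degree_le) (auto simp: co)
    show "poly.coeff P 0 = 1" using assms a by (simp add: co)
    have "poly.coeff (P\<^sup>2 - [:1, 4:]) n = 0" if n: "n < k" for n
    proof -
      have "poly.coeff (P\<^sup>2) n = (\<Sum>i\<le>n. a i * a (n - i))"
        unfolding power2_eq_square coeff_mult using n by (intro sum.cong) (auto simp: co)
      also have "\<dots> = poly.coeff [:1, 4:] n"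
      proof (cases "n \<ge> 2")
        case True
        then show ?thesis using a(3) by (auto simp: coeff_pCons split: nat.splits)
      next
        case False
        then have "n = 0 \<or> n = 1" by auto
        then show ?thesis using a(1,2) by auto
      qed
      finally show ?thesis by simp
    qed
    then show "Polynomial.monom 1 k dvd P\<^sup>2 - [:1, 4:]" by (simp add: monom_1_dvd_iff')
    fix p :: nat assume "prime p" "odd p" "p > 2 * k"
    then show "\<not> int p dvd poly.coeff P (k - 1)" using assms a(4)[of p "k - 1"] by (simp add: co)
  qed
qed

section \<open>Kloosterman sums modulo odd prime powers\<close>

locale odd_prime_power =
  fixes p k :: nat
  assumes prime: "prime p" and odd: "odd p" and k: "k \<ge> 2"
begin

section \<open>Residues modulo \<open>q\<close>, sorted by their class modulo
  \<open>p\<close>\<close>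

definition q :: nat where "q = p ^ k"

definition ev :: "int \<Rightarrow> complex" where "ev x = e2pi (real_of_int x / real q)"

definition cls :: "int \<Rightarrow> int set" where
  "cls r = {b \<in> {0..<int q}. [b = r] (mod int p)}"

definition iv :: "int \<Rightarrow> int" where "iv = modular_inverse (int q)"

lemma p_gt_1: "p > 1" using prime prime_gt_1_nat by blast

lemma q_pos: "q > 0" using p_gt_1 by (simp add: q_def)

lemma q_eq: "q = p ^ (k - 1) * p"
  using k by (simp add: q_def power_eq_if)

lemma int_q: "int q = int p ^ k" by (simp add: q_def)

lemma p_dvd_q: "int p dvd int q" using k by (simp add: int_q)

lemma cong_p_if_cong_q: "[a = b] (mod int q) \<Longrightarrow> [a = b] (mod int p)"
  using cong_dvd_modulus p_dvd_q by blast

lemma prime_int: "prime (int p)" using prime by simp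

lemma coprime_q_iff: "coprime x (int q) \<longleftrightarrow> \<not> int p dvd x"
proof -
  have "coprime x (int q) \<longleftrightarrow> coprime (int p) x"
    using k by (simp add: int_q coprime_power_right_iff coprime_commute)
  also have "\<dots> \<longleftrightarrow> \<not> int p dvd x"
    using prime_int prime_imp_coprime coprime_absorb_left not_prime_unit by blast
  finally show ?thesis .
qed

lemma not_dvd_2: "\<not> int p dvd 2"
proof
  assume "int p dvd 2"
  then have "p dvd 2" by (metis int_dvd_int_iff of_nat_numeral)
  then show False using prime odd by (metis primes_dvd_imp_eq two_is_prime_nat even_numeral)
qed

lemma cong_cancel:
  assumes "\<not> int p dvd c" "[c * a = c * b] (mod int q)"
  shows "[a = b] (mod int q)"
proof -
  have "coprime c (int q)" using assms(1) by (simp add: coprime_q_iff)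
  then show ?thesis using assms(2) by (simp add: cong_mult_lcancel)
qed

lemma dvd_q_cancel:
  assumes "int q dvd a * b" "\<not> int p dvd b"
  shows "int q dvd a"
proof -
  have "coprime (int q) b" using assms(2) by (simp add: coprime_q_iff coprime_commute)
  then show ?thesis using assms(1) by (simp add: coprime_dvd_mult_left_iff)
qed

lemma ev_cong: "[a = b] (mod int q) \<Longrightarrow> ev a = ev b"
  unfolding ev_def by (rule e2pi_cong)

lemma ev_add: "ev (a + b) = ev a * ev b"
  by (simp add: ev_def e2pi_add add_divide_distrib)

lemma norm_ev [simp]: "norm (ev a) = 1" by (simp add: ev_def)

lemma ev_diff: "ev (a - b) = ev a * cnj (ev b)"
  by (simp add: ev_def e2pi_diff diff_divide_distrib)

lemma ev_eq_1: "ev a = 1 \<Longrightarrow> int q dvd a"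
  unfolding ev_def using e2pi_eq_1_imp_dvd q_pos by blast

text \<open>This permits replacing the canonical inverse by any explicit one, such as a truncated
  geometric series.\<close>

lemma iv_cong:
  assumes "[b * c = 1] (mod int q)"
  shows "[iv b = c] (mod int q)"
proof -
  have "coprime b (int q)" using assms
    by (metis cong_imp_coprime cong_sym coprime_1_left coprime_mult_left_iff)
  then have 1: "[iv b * b = 1] (mod int q)" unfolding iv_def by (rule cong_modular_inverse2)
  have "[iv b * (b * c) = iv b * 1] (mod int q)" using assms by (rule cong_scalar_left)
  moreover have "[iv b * b * c = 1 * c] (mod int q)" using 1 by (rule cong_scalar_right)
  ultimately show ?thesis by (simp add: mult.assoc) (rule cong_trans, rule cong_sym)
qed

lemma iv: "\<not> int p dvd b \<Longrightarrow> [b * iv b = 1] (mod int q)"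
  unfolding iv_def by (rule cong_modular_inverse1) (simp add: coprime_q_iff)

lemma finite_cls [simp]: "finite (cls r)"
  by (rule finite_subset[of _ "{0..<int q}"]) (auto simp: cls_def)

lemma cls_cong: "[r = s] (mod int p) \<Longrightarrow> cls r = cls s"
  by (simp add: cls_def cong_def)

lemma card_cls: "card (cls r) = p ^ (k - 1)"
proof -
  have "cls r = (\<lambda>j. r mod int p + int p * int j) ` {..<p ^ (k - 1)}"
  proof safe
    fix b assume b: "b \<in> cls r"
    then have m: "b mod int p = r mod int p" by (simp add: cls_def cong_def)
    have nonneg: "b div int p \<ge> 0"
      using b p_gt_1 by (simp add: cls_def pos_imp_zdiv_nonneg_iff)
    have "b div int p < int (p ^ (k - 1))"
    proof (rule ccontr)
      assume "\<not> b div int p < int (p ^ (k - 1))"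
      then have "int (p ^ (k - 1)) * int p \<le> b div int p * int p"
        by (intro mult_right_mono) auto
      also have "\<dots> \<le> b" using p_gt_1 by (simp add: minus_mod_eq_div_mult[symmetric])
      finally show False using b q_eq by (simp add: cls_def)
    qed
    then have "nat (b div int p) < p ^ (k - 1)" using nonneg by linarith
    moreover have "b = r mod int p + int p * int (nat (b div int p))"
      using m nonneg by (metis add.commute int_nat_eq mult_div_mod_eq)
    ultimately show "b \<in> (\<lambda>j. r mod int p + int p * int j) ` {..<p ^ (k - 1)}" by blast
  next
    fix j :: nat assume j: "j < p ^ (k - 1)"
    have r: "0 \<le> r mod int p" "r mod int p < int p" using p_gt_1 by simp_all
    have "int p * int j \<le> int p * (int (p ^ (k - 1)) - 1)"
      using j by (intro mult_left_mono) auto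
    also have "\<dots> = int q - int p" using q_eq by (simp add: algebra_simps)
    finally show "r mod int p + int p * int j \<in> cls r" using r
      by (auto simp: cls_def cong_def)
  qed
  moreover have "inj_on (\<lambda>j. r mod int p + int p * int j) {..<p ^ (k - 1)}"
    using p_gt_1 by (auto intro!: inj_onI)
  ultimately show ?thesis by (simp add: card_image)
qed

lemma cls_cong_iff: "u \<in> cls r \<Longrightarrow> v \<in> cls s \<Longrightarrow> [u = v] (mod int q) \<Longrightarrow> u = v"
  by (auto simp: cls_def cong_def)

text \<open>All classes have the same finite size, so a substitution that is injective modulo
  \<open>q\<close> and maps one class into another is already onto.\<close>

lemma sum_cls_reindex:
  fixes g :: "int \<Rightarrow> complex"
  assumes f: "\<And>u. u \<in> cls r \<Longrightarrow> [f u = s] (mod int p)"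
    and inj: "\<And>u v. u \<in> cls r \<Longrightarrow> v \<in> cls r \<Longrightarrow> [f u = f v] (mod int q) \<Longrightarrow> [u = v] (mod int q)"
    and g: "\<And>a b. [a = b] (mod int q) \<Longrightarrow> g a = g b"
  shows "(\<Sum>b\<in>cls s. g b) = (\<Sum>u\<in>cls r. g (f u))"
proof -
  have sub: "(\<lambda>u. f u mod int q) ` cls r \<subseteq> cls s"
  proof safe
    fix u assume u: "u \<in> cls r"
    have "[f u mod int q = f u] (mod int p)" by (intro cong_p_if_cong_q) simp
    then have "[f u mod int q = s] (mod int p)" using f[OF u] by (rule cong_trans)
    then show "f u mod int q \<in> cls s" using q_pos by (simp add: cls_def)
  qed
  have inj': "inj_on (\<lambda>u. f u mod int q) (cls r)"
  proof (rule inj_onI)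
    fix u v assume uv: "u \<in> cls r" "v \<in> cls r" "f u mod int q = f v mod int q"
    from uv(3) have "[f u = f v] (mod int q)" by (simp add: cong_def)
    then have "[u = v] (mod int q)" by (rule inj[OF uv(1,2)])
    then show "u = v" using uv cls_cong_iff by blast
  qed
  have im: "(\<lambda>u. f u mod int q) ` cls r = cls s"
    by (rule card_subset_eq[OF _ sub]) (simp_all add: card_image[OF inj'] card_cls)
  have "(\<Sum>b\<in>cls s. g b) = (\<Sum>u\<in>cls r. g (f u mod int q))"
    unfolding im[symmetric] by (simp add: sum.reindex[OF inj'])
  also have "\<dots> = (\<Sum>u\<in>cls r. g (f u))" by (intro sum.cong refl g) simp
  finally show ?thesis .
qed

section \<open>Localisation of Kloosterman sums at stationary classes\<close>

definition ksum :: "int \<Rightarrow> int \<Rightarrow> int \<Rightarrow> complex" where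
  "ksum n \<beta> b = ev (n * b + \<beta> * iv b)"

lemma ksum_eq:
  assumes "[b * c = 1] (mod int q)"
  shows "ksum n \<beta> b = ev (n * b + \<beta> * c)"
  unfolding ksum_def by (intro ev_cong cong_add cong_mult iv_cong assms) auto

lemma ksum_cong:
  assumes "[a = b] (mod int q)"
  shows "ksum n \<beta> a = ksum n \<beta> b"
proof (cases "int p dvd b")
  \<comment> \<open>For non-units \<open>modular_inverse\<close> takes its default value 0, so the
    congruence persists.\<close>
  case True
  moreover have "int p dvd a" using True cong_p_if_cong_q[OF assms] by (simp add: cong_dvd_iff)
  ultimately have "iv a = 0" "iv b = 0"
    using coprime_q_iff by (simp_all add: iv_def modular_inverse_def coprime_commute)
  then show ?thesis unfolding ksum_def using assms by (intro ev_cong) (simp add: cong_scalar_left)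
next
  case False
  have "[a * iv b = b * iv b] (mod int q)" using assms by (rule cong_scalar_right)
  also have "[b * iv b = 1] (mod int q)" using False by (rule iv)
  finally have "ksum n \<beta> a = ev (n * a + \<beta> * iv b)" by (rule ksum_eq)
  also have "\<dots> = ksum n \<beta> b"
    unfolding ksum_def using assms by (intro ev_cong cong_add cong_mult) auto
  finally show ?thesis .
qed

lemma kloosterman_eq_cls: "kloosterman n \<beta> q = (\<Sum>r\<in>{0<..<int p}. \<Sum>b\<in>cls r. ksum n \<beta> b)"
proof -
  have "{b \<in> {0..<int q}. coprime b (int q)} = (\<Union>r\<in>{0<..<int p}. cls r)"
  proof (intro equalityI subsetI)
    fix b assume b: "b \<in> {b \<in> {0..<int q}. coprime b (int q)}"
    then have "b mod int p \<noteq> 0" using coprime_q_iff[of b] by (auto simp: dvd_eq_mod_eq_0)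
    then have "b mod int p \<in> {0<..<int p}" using p_gt_1
      by (simp add: order_le_neq_trans[OF pos_mod_sign])
    then show "b \<in> (\<Union>r\<in>{0<..<int p}. cls r)" using b by (auto simp: cls_def cong_def intro!: bexI[of _ "b mod int p"])
  next
    fix b assume "b \<in> (\<Union>r\<in>{0<..<int p}. cls r)"
    then obtain r where r: "r \<in> {0<..<int p}" "b \<in> cls r" by blast
    then have "b mod int p = r" by (simp add: cls_def cong_def)
    then have "\<not> int p dvd b" using r by auto
    then show "b \<in> {b \<in> {0..<int q}. coprime b (int q)}" using r
      by (auto simp: coprime_q_iff cls_def)
  qed
  moreover have "cls r \<inter> cls s = {}" if "r \<in> {0<..<int p}" "s \<in> {0<..<int p}" "r \<noteq> s" for r s
    using that by (auto simp: cls_def cong_def)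
  moreover have "kloosterman n \<beta> q = (\<Sum>b\<in>{b \<in> {0..<int q}. coprime b (int q)}. ksum n \<beta> b)"
    by (simp add: kloosterman_def ksum_def ev_def iv_def)
  ultimately show ?thesis by (simp add: sum.UNION_disjoint)
qed

lemma sum_eq_0_if_shift:
  fixes S \<omega> :: complex
  assumes "S = S * \<omega>" "\<omega> \<noteq> 1"
  shows "S = 0"
  using assms by simp

text \<open>Shifting \<open>b\<close> by \<open>p\<^sup>k\<^sup>-\<^sup>1\<close> multiplies every summand by the same nontrivial root of unity.\<close>

lemma sum_cls_eq_0:
  assumes r: "\<not> int p dvd r" and ns: "\<not> int p dvd n * r\<^sup>2 - \<beta>"
  shows "(\<Sum>b\<in>cls r. ksum n \<beta> b) = 0"
proof -
  define P where "P = int p ^ (k - 1)"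
  define \<omega> where "\<omega> = ev (P * (n - \<beta> * (iv r)\<^sup>2))"
  have qP: "int q = P * int p" using q_eq by (simp add: P_def)
  have PP: "int q dvd P\<^sup>2"
  proof -
    have "k \<le> (k - 1) * 2" using k by simp
    then show ?thesis unfolding int_q P_def power_mult[symmetric] by (rule le_imp_power_dvd)
  qed
  have "P mod int p = 0" unfolding P_def using k by (simp add: power_eq_if)
  then have Pp: "int p dvd P" by (simp add: dvd_eq_mod_eq_0)
  have shift: "ksum n \<beta> (u + P) = ksum n \<beta> u * \<omega>" if u: "u \<in> cls r" for u
  proof -
    define c where "c = iv u"
    have ur: "[u = r] (mod int p)" using u by (simp add: cls_def)
    then have "\<not> int p dvd u" using r by (simp add: cong_dvd_iff)
    then have uc: "[u * c = 1] (mod int q)" using iv c_def by blast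
    \<comment> \<open>The inverse of \<open>u + P\<close> is the geometric series cut after the
      linear term, exact modulo \<open>q\<close> because \<open>q\<close> divides the square of
      \<open>P\<close>.\<close>
    have "(u + P) * (c - P * c\<^sup>2) - 1 = (u * c - 1) * (1 - P * c) - P\<^sup>2 * c\<^sup>2"
      by (simp add: algebra_simps power2_eq_square)
    moreover have "int q dvd (u * c - 1) * (1 - P * c) - P\<^sup>2 * c\<^sup>2"
    proof (intro dvd_diff)
      show "int q dvd (u * c - 1) * (1 - P * c)"
        using uc by (intro dvd_mult2) (simp add: cong_iff_dvd_diff)
      show "int q dvd P\<^sup>2 * c\<^sup>2" using PP by (rule dvd_mult2)
    qed
    ultimately have "[(u + P) * (c - P * c\<^sup>2) = 1] (mod int q)" by (simp add: cong_iff_dvd_diff)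
    then have "ksum n \<beta> (u + P) = ev (n * (u + P) + \<beta> * (c - P * c\<^sup>2))" by (rule ksum_eq)
    also have "\<dots> = ev (n * u + \<beta> * c + P * (n - \<beta> * c\<^sup>2))" by (simp add: algebra_simps)
    also have "\<dots> = ksum n \<beta> u * ev (P * (n - \<beta> * c\<^sup>2))" by (simp add: ev_add ksum_def c_def)
    also have "ev (P * (n - \<beta> * c\<^sup>2)) = \<omega>"
    proof -
      \<comment> \<open>As \<open>q = P * p\<close>, the factor \<open>ev (P * m)\<close> depends
        only on \<open>m\<close> modulo \<open>p\<close>, hence only on the class of
        \<open>u\<close>.\<close>
      have "[r * c = u * c] (mod int p)" using ur cong_scalar_right cong_sym by blast
      also have "[u * c = 1] (mod int p)" using uc by (rule cong_p_if_cong_q)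
      also have "[1 = r * iv r] (mod int p)" using iv[OF r] cong_p_if_cong_q cong_sym by blast
      finally have "[c = iv r] (mod int p)"
        using r prime_int cong_mult_lcancel coprime_commute prime_imp_coprime by blast
      then have "[n - \<beta> * c\<^sup>2 = n - \<beta> * (iv r)\<^sup>2] (mod int p)"
        by (intro cong_diff cong_mult cong_pow) auto
      then have "[P * (n - \<beta> * c\<^sup>2) = P * (n - \<beta> * (iv r)\<^sup>2)] (mod int q)"
        unfolding qP cong_iff_dvd_diff right_diff_distrib[symmetric] by (rule mult_dvd_mono[OF dvd_refl])
      then show ?thesis unfolding \<omega>_def by (rule ev_cong)
    qed
    finally show ?thesis .
  qed
  have "(\<Sum>b\<in>cls r. ksum n \<beta> b) = (\<Sum>u\<in>cls r. ksum n \<beta> (u + P))"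
  proof (rule sum_cls_reindex)
    fix u assume "u \<in> cls r"
    then show "[u + P = r] (mod int p)" using Pp by (simp add: cls_def cong_def mod_add_eq dvd_eq_mod_eq_0 mod_add_right_eq[symmetric])
  qed (auto intro: ksum_cong simp: cong_add_rcancel)
  also have "\<dots> = (\<Sum>b\<in>cls r. ksum n \<beta> b) * \<omega>" by (simp add: shift sum_distrib_right)
  finally show ?thesis
  proof (rule sum_eq_0_if_shift)
    show "\<omega> \<noteq> 1"
    proof
      assume "\<omega> = 1"
      then have "P * int p dvd P * (n - \<beta> * (iv r)\<^sup>2)" unfolding \<omega>_def qP[symmetric] by (rule ev_eq_1)
      moreover have "P \<noteq> 0" using p_gt_1 by (simp add: P_def)
      ultimately have "int p dvd n - \<beta> * (iv r)\<^sup>2" by simp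
      \<comment> \<open>Multiplying by the square of \<open>r\<close> clears the inverse and
        recovers the excluded congruence.\<close>
      then have "int p dvd r\<^sup>2 * (n - \<beta> * (iv r)\<^sup>2) + \<beta> * ((r * iv r)\<^sup>2 - 1)"
      proof (intro dvd_add dvd_mult)
        have "[(r * iv r)\<^sup>2 = 1\<^sup>2] (mod int p)" using iv[OF r] cong_p_if_cong_q cong_pow by blast
        then show "int p dvd (r * iv r)\<^sup>2 - 1" by (simp add: cong_iff_dvd_diff)
      qed
      also have "r\<^sup>2 * (n - \<beta> * (iv r)\<^sup>2) + \<beta> * ((r * iv r)\<^sup>2 - 1) = n * r\<^sup>2 - \<beta>"
        by (simp add: algebra_simps power2_eq_square)
      finally show False using ns by simp
    qed
  qed
qed

lemma kloosterman_eq_0: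
  assumes "\<And>r. \<not> int p dvd n * r\<^sup>2 - \<beta>"
  shows "kloosterman n \<beta> q = 0"
  unfolding kloosterman_eq_cls
proof (rule sum.neutral, rule ballI)
  fix r assume "r \<in> {0<..<int p}"
  then have "\<not> int p dvd r" using zdvd_not_zless by auto
  then show "(\<Sum>b\<in>cls r. ksum n \<beta> b) = 0" using assms by (rule sum_cls_eq_0)
qed

text \<open>With \<open>y = p * z\<close> this is \<open>p\<close> times the complete quadratic
  Gauss sum modulo \<open>p ^ (k - 2)\<close>, which explains its size, the square root of
  \<open>q\<close>, when \<open>c\<close> is prime to \<open>p\<close>.\<close>

definition gauss0 :: "int \<Rightarrow> complex" where
  "gauss0 c = (\<Sum>y\<in>cls 0. ev (c * y\<^sup>2))"

text \<open>Substitute \<open>b = x u\<^sup>2\<close> with \<open>u \<equiv> 1\<close> modulo \<open>p\<close>; the phase becomes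
  \<open>n x (u\<^sup>2 + u\<^sup>-\<^sup>2) = n x (2 + (u - u\<^sup>-\<^sup>1)\<^sup>2)\<close>, and \<open>y = u - u\<^sup>-\<^sup>1\<close> runs over the multiples
  of \<open>p\<close>.\<close>

lemma sum_cls_stationary:
  assumes n: "\<not> int p dvd n" and x: "\<not> int p dvd x" and st: "[n * x\<^sup>2 = \<beta>] (mod int q)"
  shows "(\<Sum>b\<in>cls x. ksum n \<beta> b) = ev (2 * n * x) * gauss0 (n * x)"
proof -
  have u1: "[u = 1] (mod int p)" if "u \<in> cls 1" for u using that by (simp add: cls_def)
  have u_dvd: "\<not> int p dvd u" if "u \<in> cls 1" for u
    using u1[OF that] p_gt_1 by (simp add: cong_dvd_iff)
  have two: "\<not> int p dvd w" if "[w = 1 + 1] (mod int p)" for w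
    using that not_dvd_2 by (simp add: cong_dvd_iff)
  have "(\<Sum>b\<in>cls x. ksum n \<beta> b) = (\<Sum>u\<in>cls 1. ksum n \<beta> (x * u\<^sup>2))"
  proof (rule sum_cls_reindex)
    fix u assume "u \<in> cls 1"
    then have "[x * u\<^sup>2 = x * 1\<^sup>2] (mod int p)" by (intro cong_mult cong_pow u1) auto
    then show "[x * u\<^sup>2 = x] (mod int p)" by simp
  next
    fix u v assume uv: "u \<in> cls 1" "v \<in> cls 1" "[x * u\<^sup>2 = x * v\<^sup>2] (mod int q)"
    then have "[u\<^sup>2 = v\<^sup>2] (mod int q)" using cong_cancel[OF x] by blast
    then have "int q dvd (u - v) * (u + v)"
      by (simp add: cong_iff_dvd_diff power2_eq_square algebra_simps)
    moreover have "\<not> int p dvd u + v" using uv u1 by (intro two cong_add) auto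
    ultimately show "[u = v] (mod int q)" unfolding cong_iff_dvd_diff by (rule dvd_q_cancel)
  qed (rule ksum_cong)
  also have "\<dots> = (\<Sum>u\<in>cls 1. ev (2 * n * x) * ev (n * x * (u - iv u)\<^sup>2))"
  proof (rule sum.cong)
    fix u assume u: "u \<in> cls 1"
    define w where "w = iv u"
    define y where "y = iv x"
    have uw: "[u * w = 1] (mod int q)" using iv[OF u_dvd[OF u]] by (simp add: w_def)
    have xy: "[x * y = 1] (mod int q)" using iv[OF x] by (simp add: y_def)
    have "[(x * y) * (u * w)\<^sup>2 = 1 * 1\<^sup>2] (mod int q)" by (intro cong_mult cong_pow xy uw)
    then have "[(x * u\<^sup>2) * (y * w\<^sup>2) = 1] (mod int q)"
      by (simp add: power_mult_distrib mult_ac)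
    then have "ksum n \<beta> (x * u\<^sup>2) = ev (n * (x * u\<^sup>2) + \<beta> * (y * w\<^sup>2))" by (rule ksum_eq)
    also have "\<dots> = ev (2 * n * x + n * x * (u - w)\<^sup>2)"
    proof (rule ev_cong)
      have "[n * (x * u\<^sup>2) + \<beta> * (y * w\<^sup>2) = n * (x * u\<^sup>2) + (n * x\<^sup>2) * (y * w\<^sup>2)] (mod int q)"
        using st cong_sym by (intro cong_add cong_mult) auto
      also have "n * (x * u\<^sup>2) + (n * x\<^sup>2) * (y * w\<^sup>2) = n * x * u\<^sup>2 + n * x * w\<^sup>2 * (x * y)"
        by (simp add: power2_eq_square algebra_simps)
      also have "[\<dots> = n * x * u\<^sup>2 + n * x * w\<^sup>2 * 1 ] (mod int q)"
        by (intro cong_add cong_mult xy) auto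
      also have "n * x * u\<^sup>2 + n * x * w\<^sup>2 * 1 = 2 * n * x * (u * w) + n * x * (u - w)\<^sup>2"
        by (simp add: power2_eq_square algebra_simps)
      also have "[\<dots> = 2 * n * x * 1 + n * x * (u - w)\<^sup>2] (mod int q)"
        by (intro cong_add cong_mult uw) auto
      finally show "[n * (x * u\<^sup>2) + \<beta> * (y * w\<^sup>2) = 2 * n * x + n * x * (u - w)\<^sup>2] (mod int q)"
        by simp
    qed
    finally show "ksum n \<beta> (x * u\<^sup>2) = ev (2 * n * x) * ev (n * x * (u - iv u)\<^sup>2)"
      by (simp add: ev_add w_def)
  qed simp
  also have "\<dots> = ev (2 * n * x) * (\<Sum>u\<in>cls 1. ev (n * x * (u - iv u)\<^sup>2))"
    by (simp add: sum_distrib_left)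
  also have "(\<Sum>u\<in>cls 1. ev (n * x * (u - iv u)\<^sup>2)) = gauss0 (n * x)"
    unfolding gauss0_def
  proof (rule sum_cls_reindex[symmetric, where f = "\<lambda>u. u - iv u" and g = "\<lambda>y. ev (n * x * y\<^sup>2)"])
    fix u assume u: "u \<in> cls 1"
    have "[1 * iv u = u * iv u] (mod int p)"
      using u1[OF u] cong_scalar_right cong_sym by blast
    also have "[u * iv u = 1] (mod int p)" using iv[OF u_dvd[OF u]] by (rule cong_p_if_cong_q)
    finally have "[u - iv u = 1 - 1] (mod int p)" using u1[OF u] by (intro cong_diff) simp_all
    then show "[u - iv u = 0] (mod int p)" by simp
  next
    fix u v assume uv: "u \<in> cls 1" "v \<in> cls 1" "[u - iv u = v - iv v] (mod int q)"
    have a: "int q dvd u * iv u - 1" "int q dvd v * iv v - 1"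
      using iv u_dvd uv by (simp_all add: cong_iff_dvd_diff)
    have "int q dvd (u - iv u) - (v - iv v)" using uv by (simp add: cong_iff_dvd_diff)
    \<comment> \<open>Clearing the inverses factors the difference of the two values as
      \<open>(u - v) * (u * v + 1)\<close>, and \<open>u * v + 1\<close> is congruent to the unit 2
      modulo \<open>p\<close>.\<close>
    then have "int q dvd u * v * ((u - iv u) - (v - iv v)) + v * (u * iv u - 1) - u * (v * iv v - 1)"
      using a by (intro dvd_diff[OF dvd_add[OF dvd_mult dvd_mult] dvd_mult])
    also have "u * v * ((u - iv u) - (v - iv v)) + v * (u * iv u - 1) - u * (v * iv v - 1)
       = (u - v) * (u * v + 1)" by (simp add: algebra_simps)
    finally have "int q dvd (u - v) * (u * v + 1)" .
    moreover have "[u * v + 1 = 1 * 1 + 1] (mod int p)" using uv u1 by (intro cong_add cong_mult) auto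
    then have "\<not> int p dvd u * v + 1" by (intro two) simp
    ultimately show "[u = v] (mod int q)" unfolding cong_iff_dvd_diff by (rule dvd_q_cancel)
  qed (intro ev_cong cong_mult cong_pow, auto)
  finally show ?thesis .
qed

text \<open>The stationarity condition modulo \<open>p\<close> has exactly the two roots
  \<open>x\<close> and \<open>-x\<close>, distinct because \<open>p\<close> is odd. All other
  classes cancel by the shift argument.\<close>

lemma kloosterman_stationary:
  assumes n: "\<not> int p dvd n" and \<beta>: "\<not> int p dvd \<beta>" and st: "[n * x\<^sup>2 = \<beta>] (mod int q)"
  shows "kloosterman n \<beta> q = ev (2 * n * x) * gauss0 (n * x) + ev (- 2 * n * x) * gauss0 (- n * x)"
proof -
  have stp: "[n * x\<^sup>2 = \<beta>] (mod int p)" using st by (rule cong_p_if_cong_q)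
  then have "\<not> int p dvd n * x\<^sup>2" using \<beta> by (simp add: cong_dvd_iff)
  then have x: "\<not> int p dvd x" by (auto simp: power2_eq_square)
  then have x': "\<not> int p dvd - x" by simp
  define r1 r2 where "r1 = x mod int p" and "r2 = (- x) mod int p"
  have pos: "0 < y mod int p" "y mod int p < int p" if "\<not> int p dvd y" for y
    using that p_gt_1 by (simp_all add: dvd_eq_mod_eq_0 order_le_neq_trans[OF pos_mod_sign])
  have r12: "r1 \<in> {0<..<int p}" "r2 \<in> {0<..<int p}" using pos x x' by (auto simp: r1_def r2_def)
  have ne: "r1 \<noteq> r2"
  proof
    assume "r1 = r2"
    then have "int p dvd x - (- x)" by (simp add: r1_def r2_def mod_eq_dvd_iff)
    then have "int p dvd 2 * x" by simp
    then show False using x not_dvd_2 prime_int prime_dvd_mult_iff by blast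
  qed
  have zero: "(\<Sum>b\<in>cls r. ksum n \<beta> b) = 0" if r: "r \<in> {0<..<int p} - {r1, r2}" for r
  proof (rule sum_cls_eq_0)
    show "\<not> int p dvd r" using r zdvd_not_zless by auto
    show "\<not> int p dvd n * r\<^sup>2 - \<beta>"
    proof
      assume "int p dvd n * r\<^sup>2 - \<beta>"
      then have "int p dvd (n * r\<^sup>2 - \<beta>) - (n * x\<^sup>2 - \<beta>)"
        using stp unfolding cong_iff_dvd_diff by (rule dvd_diff)
      also have "(n * r\<^sup>2 - \<beta>) - (n * x\<^sup>2 - \<beta>) = n * ((r - x) * (r - (- x)))"
        by (simp add: algebra_simps power2_eq_square)
      finally have "int p dvd r - x \<or> int p dvd r - (- x)"
        using n prime_int prime_dvd_mult_iff by blast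
      then have "r mod int p = r1 \<or> r mod int p = r2" by (simp only: r1_def r2_def mod_eq_dvd_iff)
      then show False using r by auto
    qed
  qed
  have "kloosterman n \<beta> q = (\<Sum>r\<in>{r1, r2}. \<Sum>b\<in>cls r. ksum n \<beta> b)"
    unfolding kloosterman_eq_cls using r12 zero by (intro sum.mono_neutral_right) auto
  also have "\<dots> = (\<Sum>b\<in>cls r1. ksum n \<beta> b) + (\<Sum>b\<in>cls r2. ksum n \<beta> b)" using ne by simp
  also have "cls r1 = cls x" by (intro cls_cong) (simp add: r1_def)
  also have "cls r2 = cls (- x)" by (intro cls_cong) (simp add: r2_def)
  finally show ?thesis
    using sum_cls_stationary[OF n x st] sum_cls_stationary[OF n x', of \<beta>] st by simp
qed

text \<open>In the squared modulus, \<open>y = w + z\<close> makes the phase linear in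
  \<open>z\<close>. The sum over \<open>z\<close> vanishes unless \<open>p ^ (k - 1)\<close> divides
  \<open>w\<close>, which leaves at most \<open>p\<close> values of \<open>w\<close>, each
  contributing at most \<open>p ^ (k - 1)\<close>.\<close>

lemma norm_gauss0_le:
  assumes c: "\<not> int p dvd c"
  shows "norm (gauss0 c) \<le> sqrt (real q)"
proof -
  define P where "P = int p ^ (k - 1)"
  have qP: "int q = P * int p" using q_eq by (simp add: P_def)
  have inner: "(\<Sum>y\<in>cls 0. ev (c * y\<^sup>2)) * cnj (ev (c * z\<^sup>2)) =
      (\<Sum>w\<in>cls 0. ev (c * w\<^sup>2) * ev (2 * c * w * z))" if z: "z \<in> cls 0" for z
  proof -
    have "(\<Sum>y\<in>cls 0. ev (c * y\<^sup>2)) = (\<Sum>w\<in>cls 0. ev (c * (w + z)\<^sup>2))"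
    proof (rule sum_cls_reindex[where g = "\<lambda>y. ev (c * y\<^sup>2)"])
      fix w assume "w \<in> cls 0"
      then have "[w + z = 0 + 0] (mod int p)" using z by (intro cong_add) (simp_all add: cls_def)
      then show "[w + z = 0] (mod int p)" by simp
    qed (auto simp: cong_add_rcancel intro!: ev_cong cong_mult cong_pow)
    also have "\<dots> * cnj (ev (c * z\<^sup>2)) = (\<Sum>w\<in>cls 0. ev (c * (w + z)\<^sup>2 - c * z\<^sup>2))"
      by (simp add: sum_distrib_right ev_diff)
    also have "\<dots> = (\<Sum>w\<in>cls 0. ev (c * w\<^sup>2) * ev (2 * c * w * z))"
      by (intro sum.cong) (simp_all add: ev_add[symmetric] power2_eq_square algebra_simps)
    finally show ?thesis .
  qed
  have lin: "norm (\<Sum>z\<in>cls 0. ev (2 * c * w * z)) \<le> (if P dvd w then real (p ^ (k - 1)) else 0)" for w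
  proof (cases "P dvd w")
    case True
    have "norm (\<Sum>z\<in>cls 0. ev (2 * c * w * z)) \<le> (\<Sum>z\<in>cls 0. norm (ev (2 * c * w * z)))"
      by (rule norm_sum)
    then show ?thesis using True by (simp add: card_cls)
  next
    case False
    \<comment> \<open>Translation by \<open>p\<close> preserves the multiples of \<open>p\<close>
      and multiplies the sum by a root of unity different from 1.\<close>
    have "(\<Sum>z\<in>cls 0. ev (2 * c * w * z)) = (\<Sum>z\<in>cls 0. ev (2 * c * w * (z + int p)))"
    proof (rule sum_cls_reindex[where g = "\<lambda>z. ev (2 * c * w * z)"])
      fix u assume "u \<in> cls 0"
      then show "[u + int p = 0] (mod int p)" by (simp add: cls_def cong_def)
    qed (auto simp: cong_add_rcancel intro!: ev_cong cong_mult)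
    also have "\<dots> = (\<Sum>z\<in>cls 0. ev (2 * c * w * z)) * ev (2 * c * w * int p)"
      by (simp add: sum_distrib_right ev_add[symmetric] distrib_left)
    finally have "(\<Sum>z\<in>cls 0. ev (2 * c * w * z)) = 0"
    proof (rule sum_eq_0_if_shift)
      show "ev (2 * c * w * int p) \<noteq> 1"
      proof
        assume "ev (2 * c * w * int p) = 1"
        then have "P * int p dvd 2 * c * w * int p" unfolding qP[symmetric] by (rule ev_eq_1)
        then have "P dvd w * (2 * c)" using p_gt_1 by (simp add: mult_ac)
        moreover have "coprime P (2 * c)" unfolding P_def
        proof -
          have "\<not> int p dvd 2 * c" using c not_dvd_2 prime_int prime_dvd_mult_iff by blast
          then have "coprime (int p) (2 * c)" using prime_int prime_imp_coprime by blast
          then show "coprime (int p ^ (k - 1)) (2 * c)" by simp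
        qed
        ultimately have "P dvd w" using coprime_dvd_mult_left_iff by blast
        then show False using False by simp
      qed
    qed
    then show ?thesis by simp
  qed
  have "of_real ((norm (gauss0 c))\<^sup>2) = gauss0 c * cnj (gauss0 c)" by (rule complex_norm_square)
  also have "\<dots> = (\<Sum>z\<in>cls 0. gauss0 c * cnj (ev (c * z\<^sup>2)))"
    by (subst (2) gauss0_def) (simp add: sum_distrib_left)
  also have "\<dots> = (\<Sum>z\<in>cls 0. \<Sum>w\<in>cls 0. ev (c * w\<^sup>2) * ev (2 * c * w * z))"
    unfolding gauss0_def by (intro sum.cong inner refl)
  also have "\<dots> = (\<Sum>w\<in>cls 0. ev (c * w\<^sup>2) * (\<Sum>z\<in>cls 0. ev (2 * c * w * z)))"
    by (subst sum.swap) (simp add: sum_distrib_left)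
  finally have "(norm (gauss0 c))\<^sup>2 = norm (\<Sum>w\<in>cls 0. ev (c * w\<^sup>2) * (\<Sum>z\<in>cls 0. ev (2 * c * w * z)))"
    by (metis norm_of_real abs_of_nonneg zero_le_power2)
  also have "\<dots> \<le> (\<Sum>w\<in>cls 0. norm (ev (c * w\<^sup>2) * (\<Sum>z\<in>cls 0. ev (2 * c * w * z))))"
    by (rule norm_sum)
  also have "\<dots> \<le> (\<Sum>w\<in>cls 0. if P dvd w then real (p ^ (k - 1)) else 0)"
    by (intro sum_mono) (simp add: norm_mult lin)
  also have "\<dots> = real (card {w \<in> cls 0. P dvd w}) * real (p ^ (k - 1))"
    by (simp add: sum.If_cases Int_def)
  also have "\<dots> \<le> real p * real (p ^ (k - 1))"
  proof (intro mult_right_mono)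
    have "{w \<in> cls 0. P dvd w} \<subseteq> (\<lambda>j. P * int j) ` {..<p}"
    proof
      fix w assume "w \<in> {w \<in> cls 0. P dvd w}"
      then obtain j where j: "w = P * j" "0 \<le> w" "w < P * int p"
        unfolding qP[symmetric] by (auto simp: cls_def)
      have "P > 0" using p_gt_1 by (simp add: P_def)
      then have "0 \<le> j" "j < int p" using j by (simp_all add: zero_le_mult_iff)
      then show "w \<in> (\<lambda>j. P * int j) ` {..<p}" using j by (intro image_eqI[of _ _ "nat j"]) auto
    qed
    then have "card {w \<in> cls 0. P dvd w} \<le> card ((\<lambda>j. P * int j) ` {..<p})"
      by (intro card_mono) auto
    also have "\<dots> \<le> p" using card_image_le[of "{..<p}" "\<lambda>j. P * int j"] by simp
    finally show "real (card {w \<in> cls 0. P dvd w}) \<le> real p" by simp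
  qed simp
  also have "\<dots> = real q" by (simp add: q_eq)
  finally show ?thesis by (rule real_le_rsqrt)
qed

text \<open>Multiplication by the unit \<open>r\<close> permutes the multiples of \<open>p\<close>
  modulo \<open>q\<close>.\<close>

lemma gauss0_mult_square:
  assumes "\<not> int p dvd r"
  shows "gauss0 (c * r\<^sup>2) = gauss0 c"
proof -
  have "gauss0 c = (\<Sum>y\<in>cls 0. ev (c * (r * y)\<^sup>2))"
    unfolding gauss0_def
  proof (rule sum_cls_reindex[where g = "\<lambda>y. ev (c * y\<^sup>2)"])
    fix u assume "u \<in> cls 0"
    then show "[r * u = 0] (mod int p)" by (simp add: cls_def cong_0_iff)
  qed (use assms in \<open>auto intro!: ev_cong cong_mult cong_pow dest: cong_cancel\<close>)
  then show ?thesis by (simp add: gauss0_def power_mult_distrib mult_ac)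
qed

end

section \<open>Averages over an interval\<close>

context odd_prime_power
begin

section \<open>Square roots of residues congruent to 1 modulo \<open>p\<close>\<close>

lemma cong_one_not_dvd: "[s = 1] (mod int p) \<Longrightarrow> \<not> int p dvd s"
  using p_gt_1 by (simp add: cong_dvd_iff)

lemma poly_sqrt_cong:
  fixes P :: "int poly"
  assumes "Polynomial.monom 1 k dvd P\<^sup>2 - [:1, 4:]"
  shows "[(poly P (int p * y))\<^sup>2 = 1 + 4 * (int p * y)] (mod int q)"
proof -
  obtain R where R: "P\<^sup>2 - [:1, 4:] = Polynomial.monom 1 k * R" using assms by (auto elim: dvdE)
  have "(poly P Y)\<^sup>2 - (1 + 4 * Y) = Y ^ k * poly R Y" for Y
    using arg_cong[OF R, of "\<lambda>f. poly f Y"] by (simp add: poly_monom mult.commute)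
  moreover have "int q dvd (int p * y) ^ k" by (simp add: int_q power_mult_distrib)
  ultimately show ?thesis by (simp add: cong_iff_dvd_diff)
qed

lemma poly_cong_1:
  fixes P :: "int poly"
  assumes "poly.coeff P 0 = 1"
  shows "[poly P (int p * y) = 1] (mod int p)"
proof (cases P)
  case (pCons a R)
  then have "poly P (int p * y) = 1 + int p * (y * poly R (int p * y))" using assms by simp
  then show ?thesis by (simp add: cong_iff_dvd_diff)
qed

text \<open>An explicit form of Hensel lifting: the truncated series is evaluated at
  \<open>(s - 1) / 4\<close>, where 4 is invertible modulo \<open>q\<close>.\<close>

lemma ex_square_root:
  assumes "[s = 1] (mod int p)"
  shows "\<exists>r. [r\<^sup>2 = s] (mod int q) \<and> [r = 1] (mod int p)"
proof -
  obtain P :: "int poly" where P: "poly.coeff P 0 = 1" "Polynomial.monom 1 k dvd P\<^sup>2 - [:1, 4:]"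
    using ex_sqrt_poly[OF k] by blast
  obtain z where z: "s = 1 + int p * z"
    using assms unfolding cong_iff_dvd_diff by (metis add.commute diff_add_cancel dvdE)
  have "\<not> int p dvd 2 * 2" using not_dvd_2 prime_int prime_dvd_mult_iff by blast
  then have four: "[4 * iv 4 = 1] (mod int q)" using iv[of 4] by simp
  have "[(poly P (int p * (iv 4 * z)))\<^sup>2 = 1 + 4 * (int p * (iv 4 * z))] (mod int q)"
    by (rule poly_sqrt_cong[OF P(2)])
  also have "1 + 4 * (int p * (iv 4 * z)) = 1 + int p * z * (4 * iv 4)" by (simp add: algebra_simps)
  also have "[\<dots> = 1 + int p * z * 1] (mod int q)" by (intro cong_add cong_mult four cong_refl)
  finally have "[(poly P (int p * (iv 4 * z)))\<^sup>2 = s] (mod int q)" using z by simp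
  then show ?thesis using poly_cong_1[OF P(1)] by blast
qed

section \<open>Gauss sums and phases along a progression of step \<open>p\<close>\<close>

lemma gauss0_cong: "[a = b] (mod int q) \<Longrightarrow> gauss0 a = gauss0 b"
  unfolding gauss0_def by (intro sum.cong refl ev_cong cong_mult) auto

lemma gauss0_mult_cong_1:
  assumes "[s = 1] (mod int p)"
  shows "gauss0 (c * s) = gauss0 c"
proof -
  obtain r where r: "[r\<^sup>2 = s] (mod int q)" "[r = 1] (mod int p)"
    using ex_square_root[OF assms] by blast
  have "gauss0 (c * s) = gauss0 (c * r\<^sup>2)"
    using r(1) by (intro gauss0_cong cong_mult cong_refl) (rule cong_sym)
  then show ?thesis using gauss0_mult_square[OF cong_one_not_dvd[OF r(2)]] by simp
qed

text \<open>The quotient of \<beta> by \<open>r\<close> times the square of \<open>x\<close> is 1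
  modulo \<open>p\<close>, hence a square modulo \<open>q\<close>; its root corrects
  \<open>x\<close> by a factor.\<close>

lemma lift_square_root:
  assumes r: "\<not> int p dvd r" and x: "\<not> int p dvd x" and rx: "[r * x\<^sup>2 = \<beta>] (mod int p)"
  shows "\<exists>x0. [r * x0\<^sup>2 = \<beta>] (mod int q)"
proof -
  define s where "s = \<beta> * iv r * (iv x)\<^sup>2"
  have ir: "[r * iv r = 1] (mod int q)" and ix: "[x * iv x = 1] (mod int q)"
    using iv r x by auto
  have "[s = (r * x\<^sup>2) * iv r * (iv x)\<^sup>2] (mod int p)"
    unfolding s_def using rx by (intro cong_mult cong_refl) (rule cong_sym)
  also have "(r * x\<^sup>2) * iv r * (iv x)\<^sup>2 = (r * iv r) * (x * iv x)\<^sup>2" by (simp add: power_mult_distrib)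
  also have "[\<dots> = 1 * 1\<^sup>2] (mod int p)"
    by (intro cong_mult cong_pow cong_p_if_cong_q ir ix)
  finally obtain w where w: "[w\<^sup>2 = s] (mod int q)" using ex_square_root[of s] by auto
  have "r * (x * w)\<^sup>2 = r * x\<^sup>2 * w\<^sup>2" by (simp add: power_mult_distrib)
  also have "[\<dots> = r * x\<^sup>2 * s] (mod int q)" by (intro cong_mult cong_refl w)
  also have "r * x\<^sup>2 * s = \<beta> * (r * iv r) * (x * iv x)\<^sup>2" by (simp add: s_def power_mult_distrib)
  also have "[\<dots> = \<beta> * 1 * 1\<^sup>2] (mod int q)" by (intro cong_mult cong_pow cong_refl ir ix)
  finally show ?thesis by auto
qed

text \<open>Along the progression \<open>r + p t\<close> the stationary point is \<open>x0 / s(t)\<close>, where \<open>s(t)\<close>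
  is the truncated binomial series of the square root of \<open>(r + p t) / r\<close>; the phase is then
  \<open>2 r x0 s(t) / q\<close>, and the Gauss sum does not depend on \<open>t\<close>.\<close>

lemma kloosterman_progression_phase:
  assumes big: "p > 2 * k" and r: "\<not> int p dvd r" and \<beta>: "\<not> int p dvd \<beta>"
    and x: "[r * x\<^sup>2 = \<beta>] (mod int q)"
  shows "\<exists>c g A. \<not> int p dvd c \<and> \<not> int p dvd A \<and> degree g \<le> k - 1 \<and>
           poly.coeff g (k - 1) = real_of_int A / real p \<and>
           (\<forall>t. kloosterman (r + int p * t) \<beta> q =
              e2pi (poly g (real_of_int t)) * gauss0 c + e2pi (poly (- g) (real_of_int t)) * gauss0 (- c))"
proof -
  obtain P :: "int poly" where P: "degree P \<le> k - 1" "poly.coeff P 0 = 1"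
     "Polynomial.monom 1 k dvd P\<^sup>2 - [:1, 4:]" "\<not> int p dvd poly.coeff P (k - 1)"
    using ex_sqrt_poly[OF k] big prime odd by blast
  have four: "\<not> int p dvd 4"
    using not_dvd_2 prime_int prime_dvd_mult_iff[of "int p" 2 2] by simp
  \<comment> \<open>The inverse of \<open>4 * r\<close> makes
    \<open>r * (1 + 4 * (p * y * t))\<close> congruent to \<open>r + p * t\<close>, matching the
    argument of the series.\<close>
  define y where "y = iv (4 * r)"
  have "\<not> int p dvd 4 * r" using four r prime_int prime_dvd_mult_iff by blast
  then have y: "[4 * r * y = 1] (mod int q)" unfolding y_def by (rule iv)
  have y_dvd: "\<not> int p dvd y"
  proof
    assume "int p dvd y"
    then have "int p dvd 4 * r * y" by (rule dvd_mult)
    then show False using cong_one_not_dvd[OF cong_p_if_cong_q[OF y]] by simp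
  qed
  define c where "c = r * x"
  have "\<not> int p dvd r * x\<^sup>2" using \<beta> cong_p_if_cong_q[OF x] by (simp add: cong_dvd_iff)
  then have "\<not> int p dvd x" by (auto simp: power2_eq_square)
  then have c: "\<not> int p dvd c" unfolding c_def using r prime_int prime_dvd_mult_iff by blast
  define s where "s = (\<lambda>t. poly P (int p * (y * t)))"
  have s1: "[s t = 1] (mod int p)" for t unfolding s_def by (rule poly_cong_1[OF P(2)])
  have s2: "[r * (s t)\<^sup>2 = r + int p * t] (mod int q)" for t
  proof -
    have "[r * (s t)\<^sup>2 = r * (1 + 4 * (int p * (y * t)))] (mod int q)"
      unfolding s_def by (intro cong_mult cong_refl poly_sqrt_cong P)
    also have "r * (1 + 4 * (int p * (y * t))) = r + int p * t * (4 * r * y)" by (simp add: algebra_simps)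
    also have "[\<dots> = r + int p * t * 1] (mod int q)" by (intro cong_add cong_mult cong_refl y)
    finally show ?thesis by simp
  qed
  \<comment> \<open>The coefficient of \<open>t ^ (k - 1)\<close> carries \<open>p ^ (k - 1)\<close>
    from the argument and \<open>1 / q\<close> from the character, leaving exactly one
    \<open>p\<close> in the denominator.\<close>
  define A where "A = 2 * c * (poly.coeff P (k - 1) * y ^ (k - 1))"
  define g where "g = Polynomial.smult (real_of_int (2 * c) / real q)
      (pcompose (map_poly real_of_int P) [:0, real_of_int (int p * y):])"
  have coeff_g: "poly.coeff g j = real_of_int (2 * c) / real q *
      ((real_of_int (int p * y)) ^ j * real_of_int (poly.coeff P j))" for j
    by (simp add: g_def coeff_pcompose_linear coeff_map_poly)
  have poly_g: "poly g (real_of_int t) = real_of_int (2 * c * s t) / real q" for t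
  proof -
    have "poly (map_poly real_of_int P) (real_of_int u) = real_of_int (poly P u)" for u
      by (induction P) (simp_all add: map_poly_pCons)
    from this[of "int p * (y * t)"] show ?thesis
      by (simp add: g_def s_def poly_pcompose mult_ac)
  qed
  show ?thesis
  proof (intro exI conjI allI)
    show "\<not> int p dvd c" by (rule c)
    show "\<not> int p dvd A" unfolding A_def
      using c not_dvd_2 P(4) y_dvd prime_int prime_dvd_power[OF prime_int] prime_dvd_mult_iff by metis
    show "degree g \<le> k - 1"
      using P(1) by (intro degree_le) (auto simp: coeff_g coeff_eq_0)
    have "real q = real p ^ (k - 1) * real p" using q_eq by simp
    then show "poly.coeff g (k - 1) = real_of_int A / real p"
      unfolding coeff_g A_def using p_gt_1 by (simp add: power_mult_distrib field_simps)
    fix t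
    define w where "w = iv (s t)"
    have w: "[s t * w = 1] (mod int q)" unfolding w_def by (rule iv[OF cong_one_not_dvd[OF s1]])
    have "[(r + int p * t) * (x * w)\<^sup>2 = r * (s t)\<^sup>2 * (x * w)\<^sup>2] (mod int q)"
      using s2 by (intro cong_mult cong_refl) (rule cong_sym)
    also have "r * (s t)\<^sup>2 * (x * w)\<^sup>2 = (r * x\<^sup>2) * (s t * w)\<^sup>2" by (simp add: power_mult_distrib)
    also have "[\<dots> = \<beta> * 1\<^sup>2] (mod int q)" by (intro cong_mult cong_pow x w)
    finally have st: "[(r + int p * t) * (x * w)\<^sup>2 = \<beta>] (mod int q)" by simp
    have "[(r + int p * t) * (x * w) = r * (s t)\<^sup>2 * (x * w)] (mod int q)"
      using s2 by (intro cong_mult cong_refl) (rule cong_sym)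
    also have "r * (s t)\<^sup>2 * (x * w) = c * s t * (s t * w)"
      by (simp add: c_def power2_eq_square)
    also have "[\<dots> = c * s t * 1] (mod int q)" by (intro cong_mult cong_refl w)
    finally have ph: "[(r + int p * t) * (x * w) = c * s t] (mod int q)" by simp
    have nd: "\<not> int p dvd r + int p * t" using r by (simp add: dvd_add_left_iff)
    have e1: "ev (2 * (r + int p * t) * (x * w)) = e2pi (poly g (real_of_int t))"
    proof -
      have "ev (2 * (r + int p * t) * (x * w)) = ev (2 * (c * s t))"
        unfolding mult.assoc by (intro ev_cong cong_mult[OF cong_refl ph])
      then show ?thesis by (simp add: ev_def poly_g mult.assoc)
    qed
    have e2: "ev (- 2 * (r + int p * t) * (x * w)) = e2pi (poly (- g) (real_of_int t))"
    proof -
      have "ev (- 2 * (r + int p * t) * (x * w)) = ev (- 2 * (c * s t))"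
        unfolding mult.assoc by (intro ev_cong cong_mult[OF cong_refl ph])
      then show ?thesis by (simp add: ev_def poly_g mult.assoc)
    qed
    have g1: "gauss0 ((r + int p * t) * (x * w)) = gauss0 c"
      using gauss0_cong[OF ph] gauss0_mult_cong_1[OF s1] by simp
    have g2: "gauss0 (- (r + int p * t) * (x * w)) = gauss0 (- c)"
    proof -
      have "[(-1) * ((r + int p * t) * (x * w)) = (-1) * (c * s t)] (mod int q)"
        by (intro cong_mult ph cong_refl)
      then have "gauss0 (- (r + int p * t) * (x * w)) = gauss0 (- c * s t)"
        by (intro gauss0_cong) (simp only: mult_minus_left mult_1)
      then show ?thesis using gauss0_mult_cong_1[OF s1[of t], of "- c"] by simp
    qed
    show "kloosterman (r + int p * t) \<beta> q =
        e2pi (poly g (real_of_int t)) * gauss0 c + e2pi (poly (- g) (real_of_int t)) * gauss0 (- c)"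
      using kloosterman_stationary[OF nd \<beta> st] unfolding e1 e2 g1 g2 .
  qed
qed

text \<open>Solvability of the stationarity condition modulo \<open>p\<close> is the same for all
  members of the progression. If it fails, every term vanishes; otherwise two Weyl sums with
  opposite phases remain, each weighted by a Gauss sum.\<close>

lemma norm_kloosterman_progression_le:
  fixes B :: real and T :: int
  assumes big: "p > 2 * k" and r: "\<not> int p dvd r" and \<beta>: "\<not> int p dvd \<beta>" and B: "B \<ge> 0"
    and weyl: "\<And>g A. \<not> int p dvd A \<Longrightarrow> degree g \<le> k - 1 \<Longrightarrow>
         poly.coeff g (k - 1) = real_of_int A / real p \<Longrightarrow>
         norm (\<Sum>t\<in>{0..<T}. e2pi (poly g (real_of_int t))) \<le> B"
  shows "norm (\<Sum>t\<in>{0..<T}. kloosterman (r + int p * t) \<beta> q) \<le> 2 * sqrt (real q) * B"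
proof (cases "\<exists>x. [r * x\<^sup>2 = \<beta>] (mod int p)")
  case True
  then obtain x where x: "[r * x\<^sup>2 = \<beta>] (mod int p)" by blast
  then have "\<not> int p dvd r * x\<^sup>2" using \<beta> by (simp add: cong_dvd_iff)
  then have "\<not> int p dvd x" by (auto simp: power2_eq_square)
  then obtain x0 where "[r * x0\<^sup>2 = \<beta>] (mod int q)" using lift_square_root[OF r _ x] by blast
  then obtain c g A where c: "\<not> int p dvd c" and A: "\<not> int p dvd A"
    and g: "degree g \<le> k - 1" "poly.coeff g (k - 1) = real_of_int A / real p"
    and K: "\<And>t. kloosterman (r + int p * t) \<beta> q =
              e2pi (poly g (real_of_int t)) * gauss0 c + e2pi (poly (- g) (real_of_int t)) * gauss0 (- c)"
    using kloosterman_progression_phase[OF big r \<beta>] by metis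
  have "(\<Sum>t\<in>{0..<T}. kloosterman (r + int p * t) \<beta> q) =
      (\<Sum>t\<in>{0..<T}. e2pi (poly g (real_of_int t))) * gauss0 c +
      (\<Sum>t\<in>{0..<T}. e2pi (poly (- g) (real_of_int t))) * gauss0 (- c)"
    unfolding K by (simp add: sum.distrib sum_distrib_right)
  also have "norm \<dots> \<le> B * sqrt (real q) + B * sqrt (real q)"
  proof (rule norm_triangle_le, unfold norm_mult, intro add_mono mult_mono)
    show "norm (\<Sum>t\<in>{0..<T}. e2pi (poly g (real_of_int t))) \<le> B" using A g by (rule weyl)
    show "norm (\<Sum>t\<in>{0..<T}. e2pi (poly (- g) (real_of_int t))) \<le> B"
      using A g by (intro weyl[of "- A"]) auto
    show "norm (gauss0 c) \<le> sqrt (real q)" "norm (gauss0 (- c)) \<le> sqrt (real q)"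
      using c by (auto intro: norm_gauss0_le)
  qed (use B in auto)
  finally show ?thesis by (simp add: mult_ac)
next
  case False
  have "kloosterman (r + int p * t) \<beta> q = 0" for t
  proof (rule kloosterman_eq_0)
    fix x
    have "[r * x\<^sup>2 = (r + int p * t) * x\<^sup>2] (mod int p)"
      by (simp add: cong_iff_dvd_diff algebra_simps)
    then have "\<not> [(r + int p * t) * x\<^sup>2 = \<beta>] (mod int p)"
      using False cong_trans by blast
    then show "\<not> int p dvd (r + int p * t) * x\<^sup>2 - \<beta>" by (simp add: cong_iff_dvd_diff)
  qed
  then show ?thesis using B by simp
qed

lemma norm_sum_kloosterman_le:
  fixes B N :: real
  assumes big: "p > 2 * k" and \<beta>: "\<not> int p dvd \<beta>" and "N \<ge> 0" and B: "B \<ge> 0"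
    and weyl: "\<And>g A T. \<not> int p dvd A \<Longrightarrow> degree g \<le> k - 1 \<Longrightarrow>
         poly.coeff g (k - 1) = real_of_int A / real p \<Longrightarrow> real_of_int T \<le> N / real p + 1 \<Longrightarrow>
         norm (\<Sum>t\<in>{0..<T}. e2pi (poly g (real_of_int t))) \<le> B"
  shows "norm (\<Sum>n\<in>{1..\<lfloor>N\<rfloor>}. kloosterman n \<beta> q) \<le> real p * (2 * sqrt (real q) * B)"
proof -
  define M where "M = \<lfloor>N\<rfloor>"
  have M: "M \<ge> 0" "real_of_int M \<le> N" using assms(3) by (simp_all add: M_def)
  \<comment> \<open>The number of \<open>t \<ge> 0\<close> with \<open>r + p * t \<le> M\<close>;
    for \<open>M < r < p\<close> the quotient is -1 and the range is empty.\<close>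
  define T where "T = (\<lambda>r. (M - r) div int p + 1)"
  have "norm (\<Sum>n | n \<in> {1..M} \<and> n mod int p = r. kloosterman n \<beta> q) \<le> 2 * sqrt (real q) * B"
    if r: "r \<in> {0..<int p}" for r
  proof (cases "r = 0")
    case True
    \<comment> \<open>When \<open>p\<close> divides \<open>n\<close> but not \<beta>, no class is
      stationary.\<close>
    have "kloosterman n \<beta> q = 0" if "n mod int p = r" for n
    proof (rule kloosterman_eq_0)
      fix x
      have "int p dvd n * x\<^sup>2" using that True by (auto simp: dvd_eq_mod_eq_0)
      then show "\<not> int p dvd n * x\<^sup>2 - \<beta>" using \<beta> by (simp add: dvd_diff_right_iff)
    qed
    then show ?thesis using B by simp
  next
    case False
    have iff: "t < T r \<longleftrightarrow> r + int p * t \<le> M" for t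
    proof -
      have "t < T r \<longleftrightarrow> t \<le> (M - r) div int p" by (auto simp: T_def)
      also have "\<dots> \<longleftrightarrow> t * int p \<le> M - r"
      proof
        assume "t \<le> (M - r) div int p"
        then have "t * int p \<le> (M - r) div int p * int p" by (intro mult_right_mono) auto
        also have "\<dots> \<le> M - r" using p_gt_1 by (simp add: minus_mod_eq_div_mult[symmetric])
        finally show "t * int p \<le> M - r" .
      next
        assume "t * int p \<le> M - r"
        then have "t * int p div int p \<le> (M - r) div int p" using p_gt_1 by (intro zdiv_mono1) auto
        then show "t \<le> (M - r) div int p" using p_gt_1 by simp
      qed
      finally show ?thesis by (auto simp: algebra_simps)
    qed
    have "(\<Sum>n | n \<in> {1..M} \<and> n mod int p = r. kloosterman n \<beta> q) =
        (\<Sum>t\<in>{0..<T r}. kloosterman (r + int p * t) \<beta> q)"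
    proof (rule sum.reindex_bij_witness[of _ "\<lambda>t. r + int p * t" "\<lambda>n. n div int p"])
      fix n assume n: "n \<in> {n. n \<in> {1..M} \<and> n mod int p = r}"
      then have eq: "r + int p * (n div int p) = n" by auto
      then show "r + int p * (n div int p) = n" .
      show "n div int p \<in> {0..<T r}" using n eq iff p_gt_1
        by (auto simp: pos_imp_zdiv_nonneg_iff)
      show "kloosterman (r + int p * (n div int p)) \<beta> q = kloosterman n \<beta> q" using eq by simp
    next
      fix t assume t: "t \<in> {0..<T r}"
      then have "0 \<le> int p * t" by simp
      moreover have "1 \<le> r" using r False by simp
      ultimately have "1 \<le> r + int p * t" by linarith
      then show "r + int p * t \<in> {n. n \<in> {1..M} \<and> n mod int p = r}"
        using t iff[of t] r by auto
      show "(r + int p * t) div int p = t" using r by simp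
    qed
    also have "norm \<dots> \<le> 2 * sqrt (real q) * B"
    proof (rule norm_kloosterman_progression_le[OF big _ \<beta> B])
      show "\<not> int p dvd r" using r False zdvd_not_zless by auto
      have "T r \<le> M div int p + 1" unfolding T_def using r by (simp add: zdiv_mono1)
      moreover have "real_of_int (M div int p) \<le> real_of_int M / real_of_int (int p)"
        by (rule real_of_int_div4)
      moreover have "real_of_int M / real_of_int (int p) \<le> N / real p"
        using M by (simp add: divide_right_mono)
      ultimately have "real_of_int (T r) \<le> N / real p + 1" by linarith
      then show "norm (\<Sum>t\<in>{0..<T r}. e2pi (poly g (real_of_int t))) \<le> B"
        if "\<not> int p dvd A" "degree g \<le> k - 1" "poly.coeff g (k - 1) = real_of_int A / real p" for g A
        using that by (intro weyl)
    qed
    finally show ?thesis .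
  qed
  then have "norm (\<Sum>r\<in>{0..<int p}. \<Sum>n | n \<in> {1..M} \<and> n mod int p = r. kloosterman n \<beta> q)
      \<le> of_nat (card {0..<int p}) * (2 * sqrt (real q) * B)"
    by (intro sum_norm_bound) auto
  also have "(\<Sum>r\<in>{0..<int p}. \<Sum>n | n \<in> {1..M} \<and> n mod int p = r. kloosterman n \<beta> q) =
      (\<Sum>n\<in>{1..M}. kloosterman n \<beta> q)"
    using p_gt_1 by (intro sum.group) auto
  finally show ?thesis by (simp add: M_def)
qed

end

section \<open>The trivial bound and the choice of parameters\<close>

lemma norm_kloosterman_le: "norm (kloosterman m n q) \<le> real q"
proof -
  have "norm (kloosterman m n q) \<le> real (card {b \<in> {0..<int q}. coprime b (int q)}) * 1"
    unfolding kloosterman_def by (intro sum_norm_bound) auto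
  also have "card {b \<in> {0..<int q}. coprime b (int q)} \<le> card {0..<int q}"
    by (intro card_mono) auto
  finally show ?thesis by simp
qed

theorem theorem1p2:
  fixes lam :: real and k :: nat
  assumes "lam > 0"
    and "real k > max (3 / (2 * lam)) 4"
  shows "\<exists>\<delta>>0. \<exists>C>0. \<forall>(p::nat) (q::nat) (N::real) (\<beta>::int).
           prime p \<and> odd p \<and> q = p ^ k \<and> N \<ge> real q powr lam \<and> coprime \<beta> (int p) \<longrightarrow>
           norm (\<Sum>n\<in>{1..\<lfloor>N\<rfloor>}. kloosterman n \<beta> q) \<le> C * (N * real q powr (1 / 2 - \<delta>))"
proof -
  have k: "k \<ge> 5" using assms(2) by simp
  have klam: "real k * lam > 3 / 2"
    using assms by (simp add: field_simps)
  \<comment> \<open>The excess of \<open>k * lam\<close> over 3/2 is what remains after one factor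
    \<open>p\<close> for the residue classes and \<open>p powr (1 / 2)\<close> for the Weyl
    threshold; the cap 1/4 is required by \<open>weyl_bound\<close>.\<close>
  define \<epsilon> where "\<epsilon> = min (1 / 4) (real k * lam - 3 / 2)"
  have eps: "0 < \<epsilon>" "\<epsilon> \<le> 1 / 4" "3 / 2 + \<epsilon> \<le> real k * lam"
    using klam unfolding \<epsilon>_def by linarith+
  have "k - 1 \<ge> 2" using k by simp
  from weyl_bound[OF eps(1,2) this]
  obtain C \<delta> where C: "C > 0" and \<delta>: "\<delta> > 0" "\<delta> \<le> 1 / 2"
    and weyl: "\<forall>p A a b g. prime p \<longrightarrow> odd p \<longrightarrow> k - 1 < p \<longrightarrow> \<not> int p dvd A \<longrightarrow>
           degree g \<le> k - 1 \<longrightarrow> poly.coeff g (k - 1) = real_of_int A / real p \<longrightarrow>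
           real_of_int (b - a) \<le> real p powr (1 / 2 + \<epsilon>) \<longrightarrow>
           norm (\<Sum>t\<in>{a..<b}. e2pi (poly g (real_of_int t))) \<le> C * real p powr (1 / 2 + \<epsilon> - \<delta>)"
    by blast
  show ?thesis
  proof (intro exI conjI allI impI)
    \<comment> \<open>A saving of \<open>p powr \<delta>\<close> is a saving of
      \<open>q powr (\<delta> / k)\<close>. In the constant below, \<open>10 * C\<close> serves the
      primes \<open>p > 2 * k\<close> and \<open>(2 * k) ^ k\<close> the others, for which it bounds
      \<open>q\<close>.\<close>
    show "\<delta> / real k > 0" using \<delta> k by simp
    show "10 * C + (2 * real k) ^ k > 0" using C by (simp add: add_pos_nonneg)
    fix p q :: nat and N :: real and \<beta> :: int
    assume H: "prime p \<and> odd p \<and> q = p ^ k \<and> N \<ge> real q powr lam \<and> coprime \<beta> (int p)"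
    then have prime: "prime p" and odd: "odd p" and q: "q = p ^ k" and N: "N \<ge> real q powr lam"
      and cop: "coprime \<beta> (int p)" by auto
    have p1: "real p > 1" using prime prime_gt_1_nat by simp
    have q1: "real q \<ge> 1" using p1 by (simp add: q)
    have qp: "real q powr x = real p powr (real k * x)" for x
      using p1 by (simp add: q powr_realpow[symmetric] powr_powr)
    have N0: "N > 0" using N q1 by (smt (verit) powr_gt_zero)
    let ?S = "\<Sum>n\<in>{1..\<lfloor>N\<rfloor>}. kloosterman n \<beta> q"
    have "\<delta> / real k \<le> \<delta> / 1" using \<delta> k by (intro divide_left_mono) auto
    then have \<delta>k: "\<delta> / real k \<le> 1 / 2" using \<delta>(2) by linarith
    show "norm ?S \<le> (10 * C + (2 * real k) ^ k) * (N * real q powr (1 / 2 - \<delta> / real k))"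
    proof (cases "p > 2 * k")
      case True
      interpret odd_prime_power p k using prime odd k by unfold_locales auto
      have q': "odd_prime_power.q p k = q" by (simp add: q q_def)
      have \<beta>: "\<not> int p dvd \<beta>" using cop p1
        by (metis coprime_commute coprime_absorb_left not_prime_unit prime_int)
      define h where "h = real p powr (1 / 2 + \<epsilon>)"
      have h1: "h \<ge> 1" using p1 eps by (simp add: h_def ge_one_powr_ge_zero)
      \<comment> \<open>Hence \<open>N / p\<close> is at least the block length \<open>h\<close>,
        and rounding the number of blocks costs only a constant factor.\<close>
      have Nh: "real p * h \<le> N"
      proof -
        have "real p * h = real p powr (3 / 2 + \<epsilon>)"
          using p1 powr_add[of "real p" 1 "1 / 2 + \<epsilon>"] by (simp add: h_def add.assoc[symmetric])
        also have "\<dots> \<le> real p powr (real k * lam)" using eps p1 by (intro powr_mono) auto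
        also have "\<dots> \<le> N" using N by (simp add: qp)
        finally show ?thesis .
      qed
      define L where "L = nat \<lfloor>h\<rfloor>"
      have L: "real L \<le> h" "h \<le> 2 * real L" "L > 0"
      proof -
        have f: "1 \<le> \<lfloor>h\<rfloor>" using h1 by simp
        then have Lf: "real L = real_of_int \<lfloor>h\<rfloor>" by (simp add: L_def)
        have "h < real_of_int \<lfloor>h\<rfloor> + 1" "real_of_int \<lfloor>h\<rfloor> \<le> h" "1 \<le> real_of_int \<lfloor>h\<rfloor>"
          using f by simp_all
        then show "real L \<le> h" "h \<le> 2 * real L" "L > 0"
          unfolding Lf using f by (linarith, linarith, simp add: L_def)
      qed
      \<comment> \<open>At most \<open>5 * N / (p * h)\<close> blocks occur:
        \<open>T \<le> 2 * N / p\<close> and \<open>h \<le> 2 * L\<close> give the factor 4, and the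
        ceiling adds one, absorbed since \<open>N / (p * h) \<ge> 1\<close>.\<close>
      define B where "B = 5 * C * real p powr (- \<delta>) * (N / real p)"
      have "norm (\<Sum>n\<in>{1..\<lfloor>N\<rfloor>}. kloosterman n \<beta> (odd_prime_power.q p k)) \<le>
          real p * (2 * sqrt (real (odd_prime_power.q p k)) * B)"
      proof (rule norm_sum_kloosterman_le[OF True \<beta>])
        show "0 \<le> N" using N0 by simp
        show "0 \<le> B" using N0 C by (simp add: B_def)
        fix g :: "real poly" and A T :: int
        assume A: "\<not> int p dvd A" and g: "degree g \<le> k - 1" "poly.coeff g (k - 1) = real_of_int A / real p"
          and T: "real_of_int T \<le> N / real p + 1"
        define m where "m = nat \<lceil>real_of_int T / real L\<rceil>"
        have "norm (\<Sum>t\<in>{0..<T}. e2pi (poly g (real_of_int t)))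
            \<le> real m * (C * real p powr (1 / 2 + \<epsilon> - \<delta>))"
        proof (rule norm_sum_blocks_le[OF L(3)])
          fix a b :: int assume "b - a \<le> int L"
          then have "real_of_int (b - a) \<le> h" using L by linarith
          then show "norm (\<Sum>t\<in>{a..<b}. e2pi (poly g (real_of_int t)))
            \<le> C * real p powr (1 / 2 + \<epsilon> - \<delta>)"
            using prime odd True A g by (intro weyl[rule_format]) (auto simp: h_def)
        next
          have "real_of_int T / real L \<le> real m" unfolding m_def by (simp add: real_nat_ceiling_ge)
          then have "real_of_int T \<le> real m * real L" using L by (simp add: field_simps)
          then have "real_of_int (T - 0) \<le> real_of_int (int (m * L))" by simp
          then show "T - 0 \<le> int (m * L)" by (simp only: of_int_le_iff)
        qed
        also have "\<dots> \<le> 5 * (N / (real p * h)) * (C * real p powr (1 / 2 + \<epsilon> - \<delta>))"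
        proof (rule mult_right_mono)
          have Nph: "1 \<le> N / (real p * h)" using Nh p1 h1 by (simp add: field_simps)
          have "N / (real p * h) \<le> N / (real p * 1)"
            using N0 p1 h1 by (intro divide_left_mono mult_left_mono) auto
          then have "T \<le> 2 * (N / real p)" using T Nph by simp
          moreover have "real m \<le> max 0 (real_of_int T / real L) + 1"
            unfolding m_def by linarith
          moreover have "max 0 (real_of_int T / real L) \<le> 4 * (N / (real p * h))"
          proof -
            have "real_of_int T / real L \<le> 2 * (N / real p) / real L"
              using \<open>T \<le> 2 * (N / real p)\<close> by (intro divide_right_mono) auto
            also have "\<dots> \<le> 2 * (N / real p) / (h / 2)"
              using L N0 p1 h1 by (intro divide_left_mono) auto
            finally show ?thesis using N0 p1 h1 by (simp add: field_simps)
          qed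
          ultimately show "real m \<le> 5 * (N / (real p * h))" using Nph by linarith
        qed (use C in simp)
        also have "\<dots> = B"
        proof -
          have "real p powr (1 / 2 + \<epsilon> - \<delta>) = h * real p powr (- \<delta>)"
            unfolding h_def powr_add[symmetric] by simp
          then show ?thesis using h1 p1 by (simp add: B_def field_simps)
        qed
        finally show "norm (\<Sum>t\<in>{0..<T}. e2pi (poly g (real_of_int t))) \<le> B" .
      qed
      then have "norm ?S \<le> real p * (2 * sqrt (real q) * B)" by (simp add: q')
      also have "\<dots> = 10 * C * (N * real q powr (1 / 2 - \<delta> / real k))"
      proof -
        have "real q powr (1 / 2 - \<delta> / real k) = real q powr (1 / 2) * real q powr (- (\<delta> / real k))"
          by (simp flip: powr_add)
        also have "real q powr (- (\<delta> / real k)) = real p powr (- \<delta>)" using k by (simp add: qp)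
        also have "real q powr (1 / 2) = sqrt (real q)" using q1 by (simp add: powr_half_sqrt)
        finally show ?thesis using p1 by (simp add: B_def)
      qed
      also have "\<dots> \<le> (10 * C + (2 * real k) ^ k) * (N * real q powr (1 / 2 - \<delta> / real k))"
        using N0 by (intro mult_right_mono) auto
      finally show ?thesis .
    next
      case False
      \<comment> \<open>For \<open>p \<le> 2 * k\<close> the modulus is bounded in terms of
        \<open>k\<close>, so the trivial bound suffices.\<close>
      have "norm ?S \<le> of_nat (card {1..\<lfloor>N\<rfloor>}) * real q"
        by (intro sum_norm_bound norm_kloosterman_le)
      also have "\<dots> \<le> N * real q" using N0 by (intro mult_right_mono) auto
      also have "\<dots> = N * (real q powr (1 / 2 + \<delta> / real k) * real q powr (1 / 2 - \<delta> / real k))"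
        using q1 by (simp flip: powr_add)
      also have "\<dots> \<le> N * ((10 * C + (2 * real k) ^ k) * real q powr (1 / 2 - \<delta> / real k))"
      proof (intro mult_left_mono mult_right_mono)
        have "real q powr (1 / 2 + \<delta> / real k) \<le> real q powr 1"
          using q1 \<delta>k by (intro powr_mono; linarith)
        also have "\<dots> = real p ^ k" using q1 by (simp add: q)
        also have "\<dots> \<le> (2 * real k) ^ k" using False by (intro power_mono) auto
        finally show "real q powr (1 / 2 + \<delta> / real k) \<le> 10 * C + (2 * real k) ^ k" using C by simp
      qed (use N0 in auto)
      finally show ?thesis by (simp add: mult_ac)
    qed
  qed
qed

end
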